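(* Let $d,\sigma>0$ with $\sigma\le d$, and put $\gamma=\sigma^2/d^2\in(0,1]$. Let $\{X_k,\mathcal{F}_k\}_{k\ge 0}$ be a discrete-time, real-valued, conditionally symmetric martingale such that, almost surely, for every integer $k\ge 1$, $$|X_k-X_{k-1}|\le d,\qquad \operatorname{Var}(X_k\mid\mathcal{F}_{k-1})=\mathbb{E}\big[(X_k-X_{k-1})^2\mid\mathcal{F}_{k-1}\big]\le\sigma^2 .\qquad( * )$$ Then for every real $\alpha\ge 0$ and every integer $n\ge 1$, with $\delta=\alpha/d$, $$\mathbb{P}\Big(\max_{1\le k\le n}|X_k-X_0|\ge \alpha n\Big)\le 2\exp\big(-nE(\gamma,\delta)\big),$$ where $E(\gamma,\delta)\in[0,+\infty]$ is the function defined in the context. If $\delta>1$, the probability on the left-hand side is zero. Furthermore, the exponent $E(\gamma,\delta)$ is asymptotically optimal in the following sense: for all such $d,\sigma$ there exists a conditionally symmetric martingale $\{X_k,\mathcal{F}_k\}_{k\ge 0}$ (on some probability space) satisfying $( * )$ almost surely for every $k\ge 1$ and such that, for every $\alpha\ge 0$, with $\delta=\alpha/d$, $$\lim_{n\to\infty}\frac1n\ln \mathbb{P}\Big(\max_{1\le k\le n}|X_k-X_0|\ge \alpha n\Big)=-E(\gamma,\delta)$$ (with $\ln 0=-\infty$).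
   Context: A discrete-time real-valued martingale $\{X_k,\mathcal{F}_k\}_{k\ge0}$ with jumps $\xi_k=X_k-X_{k-1}$, $k\ge1$, is called conditionally symmetric if, for every $k\ge 1$, conditioned on $\mathcal{F}_{k-1}$, the random variable $\xi_k$ is symmetrically distributed around zero (i.e. $\xi_k$ and $-\xi_k$ have the same conditional law given $\mathcal{F}_{k-1}$). For $\gamma\in(0,1]$ and $\delta\in[0,1)$ define $$E(\gamma,\delta)=\delta x-\ln\big(1+\gamma[\cosh(x)-1]\big),\qquad x=\ln\left(\frac{\delta(1-\gamma)+\sqrt{\delta^2(1-\gamma)^2+\gamma^2(1-\delta^2)}}{\gamma(1-\delta)}\right).$$ Moreover $E(\gamma,1)=\ln(2/\gamma)$, and $E(\gamma,\delta)=+\infty$ for $\delta>1$, with the convention $\exp(-\infty)=0$. *)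

theory Defs
  imports "HOL-Probability.Probability"
begin

locale martingale = prob_space M + filtration "space M" F
  for M :: "'a measure" and F :: "nat \<Rightarrow> 'a measure" +
  fixes X :: "nat \<Rightarrow> 'a \<Rightarrow> real"
  assumes subalgebra_F: "\<And>k. subalgebra M (F k)"
    and adapted: "\<And>k. X k \<in> borel_measurable (F k)"
    and integrable_X: "\<And>k. integrable M (X k)"
    and cond_exp_X: "\<And>k. k \<ge> 1 \<Longrightarrow> AE \<omega> in M. real_cond_exp M (F (k - 1)) (X k) \<omega> = X (k - 1) \<omega>"

definition cond_law :: "'a measure \<Rightarrow> 'a measure \<Rightarrow> ('a \<Rightarrow> real) \<Rightarrow> real set \<Rightarrow> 'a \<Rightarrow> real" where
  "cond_law M G Y B = real_cond_exp M G (indicator {\<omega> \<in> space M. Y \<omega> \<in> B})"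

locale conditionally_symmetric_martingale = martingale M F X
  for M :: "'a measure" and F :: "nat \<Rightarrow> 'a measure" and X :: "nat \<Rightarrow> 'a \<Rightarrow> real" +
  assumes cond_symmetric: "\<And>k B. k \<ge> 1 \<Longrightarrow> B \<in> sets borel \<Longrightarrow>
    AE \<omega> in M. cond_law M (F (k - 1)) (\<lambda>\<omega>. X k \<omega> - X (k - 1) \<omega>) B \<omega>
              = cond_law M (F (k - 1)) (\<lambda>\<omega>. - (X k \<omega> - X (k - 1) \<omega>)) B \<omega>"

definition cond_variance :: "'a measure \<Rightarrow> 'a measure \<Rightarrow> ('a \<Rightarrow> real) \<Rightarrow> 'a \<Rightarrow> real" where
  "cond_variance M G Y = real_cond_exp M G (\<lambda>\<omega>. (Y \<omega> - real_cond_exp M G Y \<omega>)\<^sup>2)"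

lemma (in martingale) cond_variance_eq:
  assumes k: "k \<ge> 1"
  shows "AE \<omega> in M. cond_variance M (F (k - 1)) (X k) \<omega>
                  = real_cond_exp M (F (k - 1)) (\<lambda>\<omega>. (X k \<omega> - X (k - 1) \<omega>)\<^sup>2) \<omega>"
proof -
  interpret G: finite_measure_subalgebra M "F (k - 1)"
    by unfold_locales (rule subalgebra_F)
  have [measurable]: "X j \<in> borel_measurable M" for j
    using integrable_X by (rule borel_measurable_integrable)
  show ?thesis
    unfolding cond_variance_def
    by (rule G.real_cond_exp_cong) (use cond_exp_X[OF k] in auto)
qed

text \<open>The condition is imposed on the conditional variance; \<open>cond_variance_eq\<close> gives its
  expression by the squared increments. The bound on the increments makes the squares integrable,
  so that \<^const>\<open>real_cond_exp\<close> is meaningful here.\<close>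

definition bounded_increments ::
    "'a measure \<Rightarrow> (nat \<Rightarrow> 'a measure) \<Rightarrow> (nat \<Rightarrow> 'a \<Rightarrow> real) \<Rightarrow> real \<Rightarrow> real \<Rightarrow> bool" where
  "bounded_increments M F X d \<sigma> \<longleftrightarrow>
    (AE \<omega> in M. \<forall>k\<ge>1. \<bar>X k \<omega> - X (k - 1) \<omega>\<bar> \<le> d \<and> cond_variance M (F (k - 1)) (X k) \<omega> \<le> \<sigma>\<^sup>2)"

definition max_deviation_prob :: "'a measure \<Rightarrow> (nat \<Rightarrow> 'a \<Rightarrow> real) \<Rightarrow> nat \<Rightarrow> real \<Rightarrow> real" where
  "max_deviation_prob M X n a =
    measure M {\<omega> \<in> space M. (MAX k\<in>{1..n}. \<bar>X k \<omega> - X 0 \<omega>\<bar>) \<ge> a}"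

definition exponent_point :: "real \<Rightarrow> real \<Rightarrow> real" where
  "exponent_point \<gamma> \<delta> =
    ln ((\<delta> * (1 - \<gamma>) + sqrt (\<delta>\<^sup>2 * (1 - \<gamma>)\<^sup>2 + \<gamma>\<^sup>2 * (1 - \<delta>\<^sup>2))) / (\<gamma> * (1 - \<delta>)))"

definition exponent :: "real \<Rightarrow> real \<Rightarrow> ereal" where
  "exponent \<gamma> \<delta> =
    (if \<delta> < 1 then
       ereal (\<delta> * exponent_point \<gamma> \<delta> - ln (1 + \<gamma> * (cosh (exponent_point \<gamma> \<delta>) - 1)))
     else if \<delta> = 1 then ereal (ln (2 / \<gamma>))
     else \<infinity>)"

definition exp_ereal :: "ereal \<Rightarrow> ereal" where
  "exp_ereal x = (case x of ereal r \<Rightarrow> ereal (exp r) | PInfty \<Rightarrow> \<infinity> | MInfty \<Rightarrow> 0)"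

text \<open>The library's \<^const>\<open>ln\<close> has \<^term>\<open>ln 0 = (0 :: real)\<close>; here the value at 0 is
  \<^term>\<open>-\<infinity> :: ereal\<close>. Only nonnegative arguments are of interest.\<close>

definition ln_ereal :: "real \<Rightarrow> ereal" where
  "ln_ereal p = (if p > 0 then ereal (ln p) else -\<infinity>)"

end

theory Submission
  imports Defs
begin

text \<open>
  Write \<open>\<xi>\<^sub>k\<close> for the increments, \<open>S\<^sub>k = X\<^sub>k - X\<^sub>0\<close>, and \<open>C(x) = 1 + \<gamma> (cosh x - 1)\<close>. The function \<open>C\<close> is the
  moment generating function of the symmetric law on \<open>{-1, 0, 1}\<close> with variance \<open>\<gamma>\<close>, and
  \<open>E(\<gamma>, \<cdot>)\<close> is the Legendre transform of \<open>ln C\<close>: for \<open>\<delta> < 1\<close> the prescribed point \<open>x\<close> is the one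
  where the derivative of \<open>ln C\<close> equals \<open>\<delta>\<close> (\<open>tilted_mean_exponent_point\<close>).

  \<^bold>\<open>Upper bound.\<close> Expand \<open>cosh (\<theta> S\<^sub>k\<^sub>+\<^sub>1) = cosh (\<theta> S\<^sub>k) cosh (\<theta> \<xi>) + sinh (\<theta> S\<^sub>k) sinh (\<theta> \<xi>)\<close> with
  \<open>\<xi> = \<xi>\<^sub>k\<^sub>+\<^sub>1\<close>. Conditional symmetry removes the second term. In the first,
  \<open>cosh (\<theta> \<xi>) \<le> 1 + (\<xi> / d)\<^sup>2 (cosh (\<theta> d) - 1)\<close> for \<open>\<bar>\<xi>\<bar> \<le> d\<close>, and the bound on the conditional
  variance shows that \<open>cosh (\<theta> S\<^sub>k) / C(\<theta> d)\<^sup>k\<close> is a supermartingale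
  (\<open>expectation_cosh_supermartingale\<close>). Since \<open>cosh\<close> is even, stopping it at the first time that
  \<open>\<bar>S\<^sub>k\<bar> \<ge> a\<close> controls both tails of the maximum at once (\<open>prob_exit_le\<close>):
  \<open>P(max \<bar>S\<^sub>k\<bar> \<ge> a) \<le> C(\<theta> d)\<^sup>n / cosh (\<theta> a) \<le> 2 exp (- \<theta> a) C(\<theta> d)\<^sup>n\<close>. The stated bound is the
  choice \<open>\<theta> d = x\<close>; for \<open>\<delta> = 1\<close> one lets \<open>\<theta> \<rightarrow> \<infinity>\<close>, and for \<open>\<delta> > 1\<close> the event is null because
  \<open>\<bar>S\<^sub>k\<bar> \<le> k d\<close>.

  \<^bold>\<open>Optimality.\<close> Equality in the quadratic bound on \<open>cosh\<close> holds for increments in \<open>{-d, 0, d}\<close>, so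
  the extremal martingale is the random walk with independent steps \<open>\<plusminus>d\<close> of probability \<open>\<gamma>/2\<close>
  each. It satisfies \<open>E exp (t S\<^sub>n) = C(t d)\<^sup>n\<close>, and this identity alone gives Cramer's lower
  bound. For \<open>x < y < z\<close>, the expectation of \<open>exp (y S\<^sub>n / d)\<close> is split according to the position of
  \<open>S\<^sub>n\<close>; the parts below \<open>\<delta> d n\<close> and above \<open>b d n\<close> are bounded by exponential moments at \<open>x\<close> and \<open>z\<close>
  (\<open>tilting_lower_bound\<close>). When \<open>\<delta>\<close> and \<open>b\<close> are the slopes of \<open>ln C\<close> at \<open>x\<close> and \<open>z\<close>, strict convexity
  makes these parts exponentially negligible, so that the middle part, which is at most
  \<open>exp (y b n) P(S\<^sub>n \<ge> \<delta> d n)\<close>, carries almost all of \<open>C(y)\<^sup>n\<close>. Letting \<open>y, z\<close> tend to \<open>x\<close> gives the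
  exponent. For \<open>\<delta> = 1\<close> the event that all \<open>n\<close> steps equal \<open>d\<close> suffices.
\<close>

section \<open>The exponent as a Legendre transform\<close>

text \<open>The moment generating function of a random variable with values \<open>1\<close> and \<open>-1\<close> of probability
  \<open>\<gamma>/2\<close> each, and \<open>0\<close> otherwise.\<close>

definition step_mgf :: "real \<Rightarrow> real \<Rightarrow> real" where
  "step_mgf \<gamma> x = 1 + \<gamma> * (cosh x - 1)"

text \<open>The logarithmic derivative of \<^const>\<open>step_mgf\<close>, which is the mean of the ternary law after
  exponential tilting by \<open>x\<close>.\<close>

definition tilted_mean :: "real \<Rightarrow> real \<Rightarrow> real" where
  "tilted_mean \<gamma> x = \<gamma> * sinh x / step_mgf \<gamma> x"

lemma step_mgf_ge_1: "\<gamma> \<ge> 0 \<Longrightarrow> step_mgf \<gamma> x \<ge> 1"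
  by (simp add: step_mgf_def cosh_real_ge_1)

lemma step_mgf_pos: "\<gamma> \<ge> 0 \<Longrightarrow> step_mgf \<gamma> x > 0"
  using step_mgf_ge_1[of \<gamma> x] by linarith

lemma DERIV_ln_step_mgf:
  "\<gamma> \<ge> 0 \<Longrightarrow> ((\<lambda>x. ln (step_mgf \<gamma> x)) has_real_derivative tilted_mean \<gamma> x) (at x)"
  using step_mgf_pos[of \<gamma> x] unfolding tilted_mean_def step_mgf_def
  by (auto intro!: derivative_eq_intros simp: field_simps)

lemma isCont_tilted_mean: "\<gamma> \<ge> 0 \<Longrightarrow> isCont (tilted_mean \<gamma>) x"
  using step_mgf_pos[of \<gamma> x] unfolding tilted_mean_def step_mgf_def
  by (intro continuous_intros) auto

text \<open>This is the strict convexity of \<open>ln (step_mgf \<gamma>)\<close>. The identity \<open>cosh\<^sup>2 - sinh\<^sup>2 = 1\<close> turns the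
  numerator of the derivative into \<open>\<gamma> ((1 - \<gamma>) cosh + \<gamma>)\<close>.\<close>

lemma strict_mono_tilted_mean:
  assumes "0 < \<gamma>" "\<gamma> \<le> 1"
  shows "strict_mono (tilted_mean \<gamma>)"
proof (rule strict_monoI)
  fix x y :: real assume "x < y"
  then show "tilted_mean \<gamma> x < tilted_mean \<gamma> y"
  proof (rule DERIV_pos_imp_increasing)
    fix z :: real
    let ?C = "step_mgf \<gamma> z"
    have C: "?C > 0" using assms by (simp add: step_mgf_pos)
    have "(tilted_mean \<gamma> has_real_derivative
        ((\<gamma> * cosh z) * ?C - (\<gamma> * sinh z) * (\<gamma> * sinh z)) / (?C * ?C)) (at z)"
      using C unfolding tilted_mean_def step_mgf_def
      by (auto intro!: derivative_eq_intros)
    also have "(\<gamma> * cosh z) * ?C - (\<gamma> * sinh z) * (\<gamma> * sinh z) = \<gamma> * ((1 - \<gamma>) * cosh z + \<gamma>)"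
      using cosh_square_eq[of z] unfolding step_mgf_def by algebra
    finally have "(tilted_mean \<gamma> has_real_derivative
        \<gamma> * ((1 - \<gamma>) * cosh z + \<gamma>) / (?C * ?C)) (at z)" .
    moreover have "(1 - \<gamma>) * cosh z + \<gamma> > 0"
      using assms by (simp add: add_nonneg_pos)
    then have "\<gamma> * ((1 - \<gamma>) * cosh z + \<gamma>) / (?C * ?C) > 0"
      using C assms by simp
    ultimately show "\<exists>D. (tilted_mean \<gamma> has_real_derivative D) (at z) \<and> 0 < D"
      by blast
  qed
qed

text \<open>With \<open>y = exp x\<close>, the equation \<open>tilted_mean \<gamma> x = \<delta>\<close> is quadratic in \<open>y\<close>, and the formula for the
  exponent point is the logarithm of its positive root.\<close>

lemma tilted_mean_exponent_point:
  assumes \<gamma>: "0 < \<gamma>" "\<gamma> \<le> 1" and \<delta>: "0 \<le> \<delta>" "\<delta> < 1"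
  shows "tilted_mean \<gamma> (exponent_point \<gamma> \<delta>) = \<delta>"
proof -
  define D where "D = \<delta>\<^sup>2 * (1 - \<gamma>)\<^sup>2 + \<gamma>\<^sup>2 * (1 - \<delta>\<^sup>2)"
  define y where "y = (\<delta> * (1 - \<gamma>) + sqrt D) / (\<gamma> * (1 - \<delta>))"
  have "\<delta>\<^sup>2 < 1" using \<delta> by (simp add: abs_square_less_1)
  then have D: "D > 0" using \<gamma> \<delta> by (auto simp: D_def intro!: add_nonneg_pos)
  have y: "y > 0" using \<gamma> \<delta> D by (auto simp: y_def intro!: divide_pos_pos add_nonneg_pos)
  have "\<gamma> * (1 - \<delta>) * y - \<delta> * (1 - \<gamma>) = sqrt D"
    using \<gamma> \<delta> by (simp add: y_def)
  then have "(\<gamma> * (1 - \<delta>) * y - \<delta> * (1 - \<gamma>))\<^sup>2 = D"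
    using D by simp
  then have "\<gamma> * (1 - \<delta>) * (\<gamma> * (1 - \<delta>) * y\<^sup>2 - 2 * \<delta> * (1 - \<gamma>) * y - \<gamma> * (1 + \<delta>)) = 0"
    unfolding D_def by algebra
  then have quad: "\<gamma> * (1 - \<delta>) * y\<^sup>2 - 2 * \<delta> * (1 - \<gamma>) * y - \<gamma> * (1 + \<delta>) = 0"
    using \<gamma> \<delta> by simp
  have x: "exponent_point \<gamma> \<delta> = ln y"
    by (simp add: exponent_point_def y_def D_def)
  have C: "step_mgf \<gamma> (ln y) > 0" using \<gamma> by (simp add: step_mgf_pos)
  have "\<gamma> * (y - 1 / y) / 2 = \<delta> * (1 + \<gamma> * ((y + 1 / y) / 2 - 1))"
    using quad y by (simp add: field_simps power2_eq_square)
  then have "\<gamma> * sinh (ln y) = \<delta> * step_mgf \<gamma> (ln y)"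
    using y by (simp add: step_mgf_def sinh_ln_real cosh_ln_real inverse_eq_divide)
  then show ?thesis
    using C by (simp add: x tilted_mean_def)
qed

lemma exponent_point_nonneg:
  assumes "0 < \<gamma>" "\<gamma> \<le> 1" "0 \<le> \<delta>" "\<delta> < 1"
  shows "exponent_point \<gamma> \<delta> \<ge> 0"
proof (rule ccontr)
  assume "\<not> ?thesis"
  then have "tilted_mean \<gamma> (exponent_point \<gamma> \<delta>) < tilted_mean \<gamma> 0"
    using assms by (intro strict_monoD[OF strict_mono_tilted_mean]) auto
  then show False
    using assms by (simp add: tilted_mean_exponent_point) (simp add: tilted_mean_def)
qed

lemma ln_step_mgf_above_tangent:
  assumes \<gamma>: "0 < \<gamma>" "\<gamma> \<le> 1" and "x \<noteq> y"
  shows "ln (step_mgf \<gamma> y) > ln (step_mgf \<gamma> x) + tilted_mean \<gamma> x * (y - x)"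
proof (cases "x < y")
  case True
  obtain z where "x < z" "z < y" "ln (step_mgf \<gamma> y) - ln (step_mgf \<gamma> x) = (y - x) * tilted_mean \<gamma> z"
    using MVT2[OF True, of "\<lambda>x. ln (step_mgf \<gamma> x)" "tilted_mean \<gamma>"] \<gamma> DERIV_ln_step_mgf by auto
  moreover have "(y - x) * tilted_mean \<gamma> x < (y - x) * tilted_mean \<gamma> z"
    using strict_monoD[OF strict_mono_tilted_mean[OF \<gamma>], of x z] True \<open>x < z\<close> by simp
  ultimately show ?thesis
    by (simp add: algebra_simps)
next
  case False
  then have "y < x" using assms by simp
  then obtain z where "y < z" "z < x" "ln (step_mgf \<gamma> x) - ln (step_mgf \<gamma> y) = (x - y) * tilted_mean \<gamma> z"
    using MVT2[of y x "\<lambda>x. ln (step_mgf \<gamma> x)" "tilted_mean \<gamma>"] \<gamma> DERIV_ln_step_mgf by auto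
  moreover have "(x - y) * tilted_mean \<gamma> z < (x - y) * tilted_mean \<gamma> x"
    using strict_monoD[OF strict_mono_tilted_mean[OF \<gamma>], of z x] \<open>y < x\<close> \<open>z < x\<close> by simp
  ultimately show ?thesis
    by (simp add: algebra_simps)
qed

text \<open>Convexity of \<open>sinh\<close> on the nonnegative half-line, where \<open>sinh 0 = 0\<close>.\<close>

lemma sinh_le_scaled:
  fixes u t :: real
  assumes "u \<ge> 0" "0 \<le> t" "t \<le> 1"
  shows "sinh (t * u) \<le> t * sinh u"
proof -
  have "t * sinh 0 - sinh (t * 0) \<le> t * sinh u - sinh (t * u)"
  proof (rule DERIV_nonneg_imp_nondecreasing[OF \<open>u \<ge> 0\<close>])
    fix z :: real assume "0 \<le> z" "z \<le> u"
    have "cosh (t * z) \<le> cosh z"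
      using assms \<open>0 \<le> z\<close> by (simp add: cosh_real_nonneg_le_iff mult_left_le_one_le)
    then have "t * cosh z - t * cosh (t * z) \<ge> 0"
      using assms by (simp add: mult_left_mono)
    moreover have "((\<lambda>u. t * sinh u - sinh (t * u)) has_real_derivative t * cosh z - t * cosh (t * z)) (at z)"
      by (auto intro!: derivative_eq_intros)
    ultimately show "\<exists>D. ((\<lambda>u. t * sinh u - sinh (t * u)) has_real_derivative D) (at z) \<and> 0 \<le> D"
      by blast
  qed
  then show ?thesis by simp
qed

text \<open>The function \<open>(cosh u - 1) / u\<^sup>2\<close> is increasing in \<open>\<bar>u\<bar>\<close>; through
  \<open>cosh u - 1 = 2 sinh\<^sup>2 (u/2)\<close> this follows from the same property of \<open>sinh u / u\<close>.\<close>

lemma cosh_minus_1_le_scaled: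
  fixes u t :: real
  assumes "\<bar>t\<bar> \<le> 1"
  shows "cosh (t * u) - 1 \<le> t\<^sup>2 * (cosh u - 1)"
proof -
  have half: "cosh v - 1 = 2 * (sinh (v / 2))\<^sup>2" for v :: real
    using cosh_double_cosh[of "v / 2"] cosh_square_eq[of "v / 2"] by simp
  have "cosh (t * u) - 1 = cosh (\<bar>t\<bar> * \<bar>u\<bar>) - 1"
    by (simp flip: abs_mult)
  also have "\<dots> = 2 * (sinh (\<bar>t\<bar> * (\<bar>u\<bar> / 2)))\<^sup>2"
    by (simp add: half)
  also have "\<dots> \<le> 2 * (\<bar>t\<bar> * sinh (\<bar>u\<bar> / 2))\<^sup>2"
    using assms by (intro mult_left_mono power_mono sinh_le_scaled) auto
  also have "\<dots> = t\<^sup>2 * (cosh \<bar>u\<bar> - 1)"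
    unfolding half by (simp add: power_mult_distrib)
  finally show ?thesis by simp
qed

lemma cosh_scaled_mono:
  fixes s c \<theta> :: real
  assumes "\<bar>s\<bar> \<le> \<bar>c\<bar>"
  shows "cosh (\<theta> * s) \<le> cosh (\<theta> * c)"
proof -
  have "cosh \<bar>\<theta> * s\<bar> \<le> cosh \<bar>\<theta> * c\<bar>"
    unfolding cosh_real_nonneg_le_iff[OF abs_ge_zero abs_ge_zero]
    unfolding abs_mult using assms by (intro mult_left_mono) auto
  then show ?thesis by simp
qed

lemma abs_sinh_le_cosh: "\<bar>sinh s\<bar> \<le> cosh (s :: real)"
  by (simp add: sinh_def cosh_def abs_le_iff field_simps)

text \<open>The quadratic on the right agrees with \<open>cosh (\<theta> y)\<close> at \<open>y = -d, 0, d\<close>, which is why increments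
  with these values are extremal.\<close>

lemma cosh_le_quadratic_chord:
  fixes \<theta> y d :: real
  assumes "d > 0" "\<bar>y\<bar> \<le> d"
  shows "cosh (\<theta> * y) \<le> 1 + y\<^sup>2 * ((cosh (\<theta> * d) - 1) / d\<^sup>2)"
  using cosh_minus_1_le_scaled[of "y / d" "\<theta> * d"] assms
  by (simp add: abs_divide power_divide mult.commute)

section \<open>Conditionally symmetric martingales: the upper bound\<close>

text \<open>For each \<open>A\<close> in the \<open>\<sigma>\<close>-algebra, the laws of \<open>Y\<close> and \<open>- Y\<close> under the measure restricted to \<open>A\<close>
  agree, as one sees by integrating the two conditional laws over \<open>A\<close>. Hence \<open>h (Y)\<close> and
  \<open>h (- Y) = - h (Y)\<close> have the same integral over \<open>A\<close>, which is therefore \<open>0\<close>.\<close>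

lemma (in finite_measure_subalgebra) cond_exp_odd_function_eq_0:
  assumes Y [measurable]: "Y \<in> borel_measurable M" and h [measurable]: "h \<in> borel_measurable borel"
    and sym: "\<And>B. B \<in> sets borel \<Longrightarrow> AE \<omega> in M. cond_law M F Y B \<omega> = cond_law M F (\<lambda>\<omega>. - Y \<omega>) B \<omega>"
    and odd: "\<And>y. h (- y) = - h y"
    and int: "integrable M (\<lambda>\<omega>. h (Y \<omega>))"
  shows "AE \<omega> in M. real_cond_exp M F (\<lambda>\<omega>. h (Y \<omega>)) \<omega> = 0"
proof (rule real_cond_exp_charact)
  fix A assume A: "A \<in> sets F"
  then have AM [measurable]: "A \<in> sets M"
    using subalg by (auto simp: subalgebra_def)
  \<comment> \<open>The law of \<open>s Y\<close> on the event \<open>A\<close>; only \<open>s = 1\<close> and \<open>s = -1\<close> matter.\<close>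
  define N where "N s = distr (density M (indicator A)) borel (\<lambda>\<omega>. s * Y \<omega>)" for s :: real
  have N: "emeasure (N s) B = ennreal (\<integral>\<omega>. indicator A \<omega> * cond_law M F (\<lambda>\<omega>. s * Y \<omega>) B \<omega> \<partial>M)"
    if [measurable]: "B \<in> sets borel" for B s
  proof -
    let ?E = "{\<omega> \<in> space M. s * Y \<omega> \<in> B}"
    have "emeasure (N s) B = emeasure (density M (indicator A)) ?E"
      unfolding N_def by (subst emeasure_distr) (auto intro!: arg_cong[where f="emeasure _"])
    also have "\<dots> = emeasure M (A \<inter> ?E)"
      by (subst emeasure_density) (auto simp flip: indicator_inter_arith)
    also have "\<dots> = ennreal (measure M (A \<inter> ?E))"
      by (rule emeasure_eq_measure)
    also have "measure M (A \<inter> ?E) = (\<integral>\<omega>. indicator A \<omega> * indicator ?E \<omega> \<partial>M)"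
      by (simp flip: indicator_inter_arith)
    also have "\<dots> = (\<integral>\<omega>. indicator A \<omega> * cond_law M F (\<lambda>\<omega>. s * Y \<omega>) B \<omega> \<partial>M)"
      unfolding cond_law_def using A
      by (subst real_cond_exp_intg) (auto simp: emeasure_eq_measure simp flip: indicator_inter_arith)
    finally show ?thesis .
  qed
  have "N 1 = N (-1)"
  proof (rule measure_eqI)
    fix B assume "B \<in> sets (N 1)"
    then have B: "B \<in> sets borel" by (simp add: N_def)
    have "(\<integral>\<omega>. indicator A \<omega> * cond_law M F Y B \<omega> \<partial>M)
        = (\<integral>\<omega>. indicator A \<omega> * cond_law M F (\<lambda>\<omega>. - Y \<omega>) B \<omega> \<partial>M)"
      using sym[OF B] by (intro integral_cong_AE) (auto simp: cond_law_def)
    then show "emeasure (N 1) B = emeasure (N (-1)) B"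
      by (simp add: N[OF B])
  qed (simp add: N_def)
  moreover have N_int: "(\<integral>y. h y \<partial>N s) = (\<integral>\<omega>. indicator A \<omega> * h (s * Y \<omega>) \<partial>M)" for s
    unfolding N_def
    by (subst integral_distr, simp, simp, subst integral_density[where g="indicator A", unfolded ennreal_indicator]) auto
  ultimately have "(\<integral>\<omega>. indicator A \<omega> * h (1 * Y \<omega>) \<partial>M) = (\<integral>\<omega>. indicator A \<omega> * h (-1 * Y \<omega>) \<partial>M)"
    by (simp only: N_int[symmetric])
  then have "(\<integral>\<omega>. indicator A \<omega> * h (Y \<omega>) \<partial>M) = 0"
    by (simp add: odd)
  then show "(\<integral>\<omega>\<in>A. h (Y \<omega>) \<partial>M) = (\<integral>\<omega>\<in>A. 0 \<partial>M)"
    by (simp add: set_lebesgue_integral_def)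
qed (auto intro: int)

context conditionally_symmetric_martingale
begin

lemma finite_measure_subalgebra_F: "finite_measure_subalgebra M (F k)"
  by unfold_locales (rule subalgebra_F)

lemma X_measurable [measurable]: "X k \<in> borel_measurable M"
  using integrable_X by (rule borel_measurable_integrable)

lemma adapted_later:
  assumes "j \<le> k"
  shows "X j \<in> borel_measurable (F k)"
proof -
  have "subalgebra (F k) (F j)"
    using sets_F_mono[OF assms] by (simp add: subalgebra_def space_F)
  then show ?thesis
    using adapted by (rule measurable_from_subalg)
qed

lemma AE_deviation_le:
  assumes "bounded_increments M F X d \<sigma>"
  shows "AE \<omega> in M. \<forall>k. \<bar>X k \<omega> - X 0 \<omega>\<bar> \<le> real k * d"
  using assms unfolding bounded_increments_def
proof eventually_elim
  case (elim \<omega>)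
  show ?case
  proof
    fix k show "\<bar>X k \<omega> - X 0 \<omega>\<bar> \<le> real k * d"
    proof (induction k)
      case (Suc k)
      have "\<bar>X (Suc k) \<omega> - X k \<omega>\<bar> \<le> d"
        using elim[rule_format, of "Suc k"] by simp
      then show ?case using Suc by (simp add: algebra_simps)
    qed simp
  qed
qed

lemma AE_increment_le:
  assumes "bounded_increments M F X d \<sigma>"
  shows "AE \<omega> in M. \<bar>X (Suc k) \<omega> - X k \<omega>\<bar> \<le> d"
    and "AE \<omega> in M. real_cond_exp M (F k) (\<lambda>\<omega>. (X (Suc k) \<omega> - X k \<omega>)\<^sup>2) \<omega> \<le> \<sigma>\<^sup>2"
proof -
  have *: "AE \<omega> in M. \<bar>X (Suc k) \<omega> - X k \<omega>\<bar> \<le> d \<and> cond_variance M (F k) (X (Suc k)) \<omega> \<le> \<sigma>\<^sup>2"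
    using assms unfolding bounded_increments_def
    by eventually_elim (metis diff_Suc_1 le_add1 plus_1_eq_Suc)
  then show "AE \<omega> in M. \<bar>X (Suc k) \<omega> - X k \<omega>\<bar> \<le> d"
    by eventually_elim simp
  show "AE \<omega> in M. real_cond_exp M (F k) (\<lambda>\<omega>. (X (Suc k) \<omega> - X k \<omega>)\<^sup>2) \<omega> \<le> \<sigma>\<^sup>2"
    using * cond_variance_eq[of "Suc k", simplified]
    by eventually_elim simp
qed

text \<open>The supermartingale inequality for \<open>cosh (\<theta> S\<^sub>k) / C\<^sup>k\<close>, tested on an event \<open>A\<close> of the past.\<close>

lemma expectation_cosh_supermartingale:
  assumes bnd: "bounded_increments M F X d \<sigma>" and d: "d > 0" and A: "A \<in> sets (F k)"
  shows "expectation (\<lambda>\<omega>. indicator A \<omega> * cosh (\<theta> * (X (Suc k) \<omega> - X 0 \<omega>)))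
    \<le> step_mgf (\<sigma>\<^sup>2 / d\<^sup>2) (\<theta> * d) * expectation (\<lambda>\<omega>. indicator A \<omega> * cosh (\<theta> * (X k \<omega> - X 0 \<omega>)))"
proof -
  interpret F: finite_measure_subalgebra M "F k" by (rule finite_measure_subalgebra_F)
  define Y where "Y \<omega> = X (Suc k) \<omega> - X k \<omega>" for \<omega>
  define G where "G \<omega> = indicator A \<omega> * cosh (\<theta> * (X k \<omega> - X 0 \<omega>))" for \<omega>
  define H where "H \<omega> = indicator A \<omega> * sinh (\<theta> * (X k \<omega> - X 0 \<omega>))" for \<omega>
  define \<kappa> where "\<kappa> = (cosh (\<theta> * d) - 1) / d\<^sup>2"
  have \<kappa>: "\<kappa> \<ge> 0" by (simp add: \<kappa>_def cosh_real_ge_1)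
  note [measurable] = A adapted_later[of 0 k] adapted_later[of k k]
  have GF: "G \<in> borel_measurable (F k)" and HF: "H \<in> borel_measurable (F k)"
    unfolding G_def H_def by (auto simp: cosh_def sinh_def)
  note [measurable] = measurable_from_subalg[OF F.subalg GF] measurable_from_subalg[OF F.subalg HF]
  have Y [measurable]: "Y \<in> borel_measurable M"
    unfolding Y_def by measurable
  have hyp [measurable]: "cosh \<in> borel_measurable (borel :: real measure)" "sinh \<in> borel_measurable (borel :: real measure)"
    by (auto intro!: borel_measurable_continuous_onI continuous_intros)
  have G0: "G \<omega> \<ge> 0" for \<omega> by (simp add: G_def)
  have Yd: "AE \<omega> in M. \<bar>Y \<omega>\<bar> \<le> d"
    unfolding Y_def by (rule AE_increment_le(1)[OF bnd])
  have Gb: "AE \<omega> in M. \<bar>G \<omega>\<bar> \<le> cosh (\<theta> * (k * d))"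
    using AE_deviation_le[OF bnd]
    by eventually_elim (auto simp: G_def indicator_def intro!: cosh_scaled_mono order_trans[OF _ abs_ge_self])
  have Hb: "AE \<omega> in M. \<bar>H \<omega>\<bar> \<le> cosh (\<theta> * (k * d))"
    using AE_deviation_le[OF bnd]
    by eventually_elim (auto simp: H_def indicator_def
      intro!: order_trans[OF abs_sinh_le_cosh] cosh_scaled_mono order_trans[OF _ abs_ge_self])
  have bounded_int: "integrable M (\<lambda>\<omega>. u \<omega> * v \<omega>)"
    if [measurable]: "u \<in> borel_measurable M" "v \<in> borel_measurable M"
      and "AE \<omega> in M. \<bar>u \<omega>\<bar> \<le> b" "AE \<omega> in M. \<bar>v \<omega>\<bar> \<le> c" for u v :: "'a \<Rightarrow> real" and b c
  proof (rule integrable_const_bound[where B="b * c"])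
    show "AE \<omega> in M. norm (u \<omega> * v \<omega>) \<le> b * c"
      using that(3,4) by eventually_elim (auto simp: abs_mult intro!: mult_mono)
  qed measurable
  have cb: "AE \<omega> in M. \<bar>cosh (\<theta> * Y \<omega>)\<bar> \<le> cosh (\<theta> * d)"
    using Yd by eventually_elim (auto intro!: cosh_scaled_mono)
  have sb: "AE \<omega> in M. \<bar>sinh (\<theta> * Y \<omega>)\<bar> \<le> cosh (\<theta> * d)"
    using Yd by eventually_elim (auto intro!: order_trans[OF abs_sinh_le_cosh] cosh_scaled_mono)
  have qb: "AE \<omega> in M. \<bar>(Y \<omega>)\<^sup>2\<bar> \<le> d\<^sup>2"
    using Yd by eventually_elim (simp add: abs_le_square_iff[symmetric] abs_of_pos d)
  have iG: "integrable M G"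
    by (rule integrable_const_bound[OF Gb[folded real_norm_def]]) measurable
  have iGc: "integrable M (\<lambda>\<omega>. G \<omega> * cosh (\<theta> * Y \<omega>))"
    by (rule bounded_int[OF _ _ Gb cb]) measurable
  have iHs: "integrable M (\<lambda>\<omega>. H \<omega> * sinh (\<theta> * Y \<omega>))"
    by (rule bounded_int[OF _ _ Hb sb]) measurable
  have iGq: "integrable M (\<lambda>\<omega>. G \<omega> * (Y \<omega>)\<^sup>2)"
    by (rule bounded_int[OF _ _ Gb qb]) measurable
  have iS: "integrable M (\<lambda>\<omega>. sinh (\<theta> * Y \<omega>))"
    by (rule integrable_const_bound[OF sb[folded real_norm_def]]) measurable

  \<comment> \<open>Symmetry: the product of the hyperbolic sines has expectation zero.\<close>
  have "AE \<omega> in M. real_cond_exp M (F k) (\<lambda>\<omega>. sinh (\<theta> * Y \<omega>)) \<omega> = 0"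
    using cond_symmetric[of "Suc k"] iS
    by (intro F.cond_exp_odd_function_eq_0) (auto simp: Y_def [abs_def])
  then have "(\<integral>\<omega>. H \<omega> * real_cond_exp M (F k) (\<lambda>\<omega>. sinh (\<theta> * Y \<omega>)) \<omega> \<partial>M) = (\<integral>\<omega>. 0 \<partial>M)"
    by (intro integral_cong_AE) auto
  then have odd_part: "(\<integral>\<omega>. H \<omega> * sinh (\<theta> * Y \<omega>) \<partial>M) = 0"
    using F.real_cond_exp_intg(2)[OF iHs HF] by simp

  \<comment> \<open>The variance bound, weighted by the nonnegative past variable \<open>G\<close>.\<close>
  have "(\<integral>\<omega>. G \<omega> * (Y \<omega>)\<^sup>2 \<partial>M) = (\<integral>\<omega>. G \<omega> * real_cond_exp M (F k) (\<lambda>\<omega>. (Y \<omega>)\<^sup>2) \<omega> \<partial>M)"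
    using F.real_cond_exp_intg(2)[OF iGq GF] by simp
  also have "\<dots> \<le> (\<integral>\<omega>. G \<omega> * \<sigma>\<^sup>2 \<partial>M)"
  proof (rule integral_mono_AE)
    show "AE \<omega> in M. G \<omega> * real_cond_exp M (F k) (\<lambda>\<omega>. (Y \<omega>)\<^sup>2) \<omega> \<le> G \<omega> * \<sigma>\<^sup>2"
      using AE_increment_le(2)[OF bnd, of k] unfolding Y_def[symmetric]
      by eventually_elim (auto intro: mult_left_mono G0)
  qed (use iG F.real_cond_exp_intg(1)[OF iGq GF] in auto)
  finally have variance_part: "(\<integral>\<omega>. G \<omega> * (Y \<omega>)\<^sup>2 \<partial>M) \<le> \<sigma>\<^sup>2 * (\<integral>\<omega>. G \<omega> \<partial>M)"
    by (simp add: mult.commute)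

  have "(\<integral>\<omega>. indicator A \<omega> * cosh (\<theta> * (X (Suc k) \<omega> - X 0 \<omega>)) \<partial>M)
      = (\<integral>\<omega>. G \<omega> * cosh (\<theta> * Y \<omega>) + H \<omega> * sinh (\<theta> * Y \<omega>) \<partial>M)"
  proof (intro Bochner_Integration.integral_cong refl)
    fix \<omega>
    have "\<theta> * (X (Suc k) \<omega> - X 0 \<omega>) = \<theta> * (X k \<omega> - X 0 \<omega>) + \<theta> * Y \<omega>"
      by (simp add: Y_def algebra_simps)
    then show "indicator A \<omega> * cosh (\<theta> * (X (Suc k) \<omega> - X 0 \<omega>)) = G \<omega> * cosh (\<theta> * Y \<omega>) + H \<omega> * sinh (\<theta> * Y \<omega>)"
      by (simp add: cosh_add G_def H_def distrib_left)
  qed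
  also have "\<dots> = (\<integral>\<omega>. G \<omega> * cosh (\<theta> * Y \<omega>) \<partial>M)"
    using iGc iHs odd_part by simp
  also have "\<dots> \<le> (\<integral>\<omega>. G \<omega> + \<kappa> * (G \<omega> * (Y \<omega>)\<^sup>2) \<partial>M)"
  proof (rule integral_mono_AE)
    show "AE \<omega> in M. G \<omega> * cosh (\<theta> * Y \<omega>) \<le> G \<omega> + \<kappa> * (G \<omega> * (Y \<omega>)\<^sup>2)"
      using Yd
    proof eventually_elim
      case (elim \<omega>)
      have "G \<omega> * cosh (\<theta> * Y \<omega>) \<le> G \<omega> * (1 + (Y \<omega>)\<^sup>2 * \<kappa>)"
        unfolding \<kappa>_def using elim d by (intro mult_left_mono cosh_le_quadratic_chord G0)
      then show ?case by (simp add: algebra_simps)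
    qed
  qed (use iG iGc iGq in auto)
  also have "\<dots> = (\<integral>\<omega>. G \<omega> \<partial>M) + \<kappa> * (\<integral>\<omega>. G \<omega> * (Y \<omega>)\<^sup>2 \<partial>M)"
    using iG iGq by simp
  also have "\<dots> \<le> (\<integral>\<omega>. G \<omega> \<partial>M) + \<kappa> * (\<sigma>\<^sup>2 * (\<integral>\<omega>. G \<omega> \<partial>M))"
    using variance_part \<kappa> by (intro add_left_mono mult_left_mono)
  also have "\<dots> = step_mgf (\<sigma>\<^sup>2 / d\<^sup>2) (\<theta> * d) * (\<integral>\<omega>. G \<omega> \<partial>M)"
    by (simp add: step_mgf_def \<kappa>_def algebra_simps)
  finally show ?thesis
    unfolding G_def .
qed

text \<open>A maximal inequality. The quantity \<open>U k k\<close> below is the expectation of the process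
  \<open>cosh (\<theta> S)\<close> stopped when \<open>\<bar>S\<bar>\<close> reaches \<open>a\<close>, with its value from then on lowered to \<open>cosh (\<theta> a)\<close>.
  Lowering the value absorbs the overshoot, so \<open>U\<close> grows by a factor of at most \<open>C\<close> in each step.\<close>

lemma prob_exit_le:
  assumes bnd: "bounded_increments M F X d \<sigma>" and d: "d > 0" and a: "a \<ge> 0"
  shows "cosh (\<theta> * a) * prob {\<omega> \<in> space M. \<exists>j\<le>n. \<bar>X j \<omega> - X 0 \<omega>\<bar> \<ge> a}
    \<le> step_mgf (\<sigma>\<^sup>2 / d\<^sup>2) (\<theta> * d) ^ n"
proof -
  define C where "C = step_mgf (\<sigma>\<^sup>2 / d\<^sup>2) (\<theta> * d)"
  have C: "C \<ge> 1" by (simp add: C_def step_mgf_ge_1)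
  \<comment> \<open>The event of no exit up to time \<open>k\<close>. The second index \<open>l\<close> of \<open>V\<close> and \<open>U\<close> is the time at which the
    process is evaluated: a step first moves \<open>l\<close>, then updates \<open>k\<close>.\<close>
  define A where "A k = {\<omega> \<in> space M. \<forall>j\<le>k. \<bar>X j \<omega> - X 0 \<omega>\<bar> < a}" for k
  define V where "V k l \<omega> = indicator (A k) \<omega> * cosh (\<theta> * (X l \<omega> - X 0 \<omega>))" for k l \<omega>
  have AF: "A k \<in> sets (F k)" for k
  proof -
    have "{\<omega> \<in> space (F k). \<bar>X j \<omega> - X 0 \<omega>\<bar> < a} \<in> sets (F k)" if "j \<in> {..k}" for j
    proof -
      have [measurable]: "X j \<in> borel_measurable (F k)" "X 0 \<in> borel_measurable (F k)"
        using that by (auto intro: adapted_later)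
      show ?thesis by simp
    qed
    then have "{\<omega> \<in> space (F k). \<forall>j\<in>{..k}. \<bar>X j \<omega> - X 0 \<omega>\<bar> < a} \<in> sets (F k)"
      by (rule sets.sets_Collect_finite_All) simp_all
    also have "{\<omega> \<in> space (F k). \<forall>j\<in>{..k}. \<bar>X j \<omega> - X 0 \<omega>\<bar> < a} = A k"
      unfolding A_def space_F by blast
    finally show ?thesis .
  qed
  have AM [measurable]: "A k \<in> sets M" for k
    using AF[of k] subalgebra_F[of k] by (auto simp: subalgebra_def)
  have iV: "integrable M (V k l)" for k l
  proof (rule integrable_const_bound[where B="cosh (\<theta> * (l * d))"])
    show "AE \<omega> in M. norm (V k l \<omega>) \<le> cosh (\<theta> * (l * d))"
      using AE_deviation_le[OF bnd]
      by eventually_elim (auto simp: V_def indicator_def intro!: cosh_scaled_mono order_trans[OF _ abs_ge_self])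
    show "V k l \<in> borel_measurable M"
      unfolding V_def[abs_def] cosh_def by measurable
  qed
  have iI: "integrable M (\<lambda>\<omega>. cosh (\<theta> * a) * indicator (space M - A k) \<omega>)" for k
    by (intro integrable_mult_right integrable_real_indicator) (auto simp: emeasure_eq_measure)
  define U where "U k l = cosh (\<theta> * a) * prob (space M - A k) + expectation (V k l)" for k l
  have Uint: "U k l = expectation (\<lambda>\<omega>. cosh (\<theta> * a) * indicator (space M - A k) \<omega> + V k l \<omega>)" for k l
    using iV iI by (subst Bochner_Integration.integral_add) (auto simp: U_def Int_absorb2)
  have "U n n \<le> C ^ n"
  proof (induction n)
    case 0
    \<comment> \<open>For \<open>a = 0\<close> the exit happens at time \<open>0\<close>, where \<open>cosh (\<theta> a) = 1\<close>.\<close>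
    show ?case
    proof (cases "a = 0")
      case True
      then have "A 0 = {}" by (simp add: A_def)
      then show ?thesis using True by (simp add: U_def V_def[abs_def] prob_space)
    next
      case False
      then have "A 0 = space M" using a by (simp add: A_def)
      then show ?thesis by (simp add: U_def V_def[abs_def] prob_space)
    qed
  next
    case (Suc n)
    have "U (Suc n) (Suc n) \<le> U n (Suc n)"
      unfolding Uint
    proof (rule integral_mono)
      fix \<omega> assume \<omega>: "\<omega> \<in> space M"
      have "\<omega> \<in> A (Suc n) \<longleftrightarrow> \<omega> \<in> A n \<and> \<bar>X (Suc n) \<omega> - X 0 \<omega>\<bar> < a"
        using \<omega> by (auto simp: A_def le_Suc_eq)
      then show "cosh (\<theta> * a) * indicator (space M - A (Suc n)) \<omega> + V (Suc n) (Suc n) \<omega>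
          \<le> cosh (\<theta> * a) * indicator (space M - A n) \<omega> + V n (Suc n) \<omega>"
        using \<omega> a by (auto simp: V_def indicator_def intro!: cosh_scaled_mono)
    qed (intro Bochner_Integration.integrable_add iV iI)+
    also have "\<dots> \<le> cosh (\<theta> * a) * prob (space M - A n) + C * expectation (V n n)"
      using expectation_cosh_supermartingale[OF bnd d AF[of n], of \<theta>]
      by (simp add: U_def C_def V_def[abs_def])
    also have "\<dots> \<le> C * U n n"
      using C mult_right_mono[of 1 C "cosh (\<theta> * a) * prob (space M - A n)"]
      by (simp add: U_def distrib_left)
    also have "\<dots> \<le> C * C ^ n"
      using Suc C by (intro mult_left_mono) auto
    finally show ?case by simp
  qed
  moreover have "cosh (\<theta> * a) * prob (space M - A n) \<le> U n n"
    by (simp add: U_def V_def)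
  moreover have "space M - A n = {\<omega> \<in> space M. \<exists>j\<le>n. \<bar>X j \<omega> - X 0 \<omega>\<bar> \<ge> a}"
    by (auto simp: A_def not_less)
  ultimately show ?thesis
    by (simp add: C_def)
qed

text \<open>Chernoff form of \<open>prob_exit_le\<close>, from \<open>cosh t \<ge> exp t / 2\<close>; the factor \<open>2\<close> of the final bound
  arises here.\<close>

lemma max_deviation_le:
  assumes bnd: "bounded_increments M F X d \<sigma>" and d: "d > 0" and a: "a \<ge> 0" and n: "n \<ge> 1"
  shows "max_deviation_prob M X n a \<le> 2 * (exp (- \<theta> * a) * step_mgf (\<sigma>\<^sup>2 / d\<^sup>2) (\<theta> * d) ^ n)"
proof -
  let ?D = "{\<omega> \<in> space M. \<exists>j\<le>n. \<bar>X j \<omega> - X 0 \<omega>\<bar> \<ge> a}"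
  have "max_deviation_prob M X n a \<le> prob ?D"
    unfolding max_deviation_prob_def using n
    by (intro finite_measure_mono) (auto simp: Max_ge_iff)
  moreover have "exp (\<theta> * a) / 2 * prob ?D \<le> cosh (\<theta> * a) * prob ?D"
    by (intro mult_right_mono) (auto simp: cosh_def)
  ultimately have "exp (\<theta> * a) / 2 * max_deviation_prob M X n a \<le> step_mgf (\<sigma>\<^sup>2 / d\<^sup>2) (\<theta> * d) ^ n"
    using prob_exit_le[OF bnd d a, of \<theta> n]
    by (meson exp_ge_zero divide_nonneg_pos mult_left_mono order_trans zero_less_numeral)
  then show ?thesis
    by (simp add: exp_minus field_simps)
qed

lemma max_deviation_eq_0:
  assumes bnd: "bounded_increments M F X d \<sigma>" and n: "n \<ge> 1" and d: "d > 0" and a: "a > n * d"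
  shows "max_deviation_prob M X n a = 0"
proof -
  have "AE \<omega> in M. \<not> (MAX k\<in>{1..n}. \<bar>X k \<omega> - X 0 \<omega>\<bar>) \<ge> a"
    using AE_deviation_le[OF bnd]
  proof eventually_elim
    case (elim \<omega>)
    have "\<bar>X k \<omega> - X 0 \<omega>\<bar> < a" if "k \<le> n" for k
    proof -
      have "\<bar>X k \<omega> - X 0 \<omega>\<bar> \<le> k * d" using elim by simp
      also have "\<dots> \<le> n * d" using that d by simp
      finally show ?thesis using a by simp
    qed
    then show ?case using n by (auto simp: Max_ge_iff not_le)
  qed
  then show ?thesis
    unfolding max_deviation_prob_def by (subst prob_eq_0) auto
qed

text \<open>The bound of \<open>max_deviation_le\<close> at the exponent point for \<open>\<delta> < 1\<close>. For \<open>\<delta> = 1\<close> the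
  infimum over \<open>\<theta>\<close> is not attained and a limit is needed.\<close>

lemma max_deviation_le_exponent:
  assumes bnd: "bounded_increments M F X d \<sigma>" and d: "d > 0" and \<gamma>: "\<gamma> = \<sigma>\<^sup>2 / d\<^sup>2" "\<gamma> > 0"
    and \<alpha>: "\<alpha> \<ge> 0" and n: "n \<ge> 1"
  shows "ereal (max_deviation_prob M X n (\<alpha> * real n))
    \<le> 2 * exp_ereal (- (ereal (real n) * exponent \<gamma> (\<alpha> / d)))"
proof -
  let ?p = "max_deviation_prob M X n (\<alpha> * real n)"
  have le: "?p \<le> 2 * (exp (- (x * (\<alpha> / d))) * step_mgf \<gamma> x) ^ n" for x
    using max_deviation_le[OF bnd d, of "\<alpha> * real n" n "x / d"] d \<alpha> n
    by (simp add: \<gamma>(1) power_mult_distrib mult_ac flip: exp_of_nat_mult)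
  consider "\<alpha> / d < 1" | "\<alpha> / d = 1" | "\<alpha> / d > 1" by linarith
  then show ?thesis
  proof cases
    case 1
    define x where "x = exponent_point \<gamma> (\<alpha> / d)"
    have "exp (- (x * (\<alpha> / d))) * step_mgf \<gamma> x = exp (- (\<alpha> / d * x - ln (step_mgf \<gamma> x)))"
      using step_mgf_pos[of \<gamma> x] \<gamma> by (simp add: exp_minus exp_diff field_simps)
    then have "(exp (- (x * (\<alpha> / d))) * step_mgf \<gamma> x) ^ n
        = exp (- (n * (\<alpha> / d * x - ln (step_mgf \<gamma> x))))"
      by (metis exp_of_nat_mult mult_minus_right)
    then have "?p \<le> 2 * exp (- (n * (\<alpha> / d * x - ln (step_mgf \<gamma> x))))"
      using le[of x] by metis
    then show ?thesis
      using 1 by (simp add: exponent_def exp_ereal_def numeral_eq_ereal step_mgf_def x_def)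
  next
    case 2
    \<comment> \<open>The bound at \<open>\<theta> d = - ln u\<close>; it is a polynomial in \<open>u\<close>, so \<open>\<theta> \<rightarrow> \<infinity>\<close> becomes \<open>u \<rightarrow> 0\<close>.\<close>
    define f where "f u = 2 * (u * (1 - \<gamma>) + \<gamma> / 2 * (1 + u\<^sup>2)) ^ n" for u :: real
    have "?p \<le> f u" if u: "u > 0" for u
    proof -
      have "exp (- (- ln u * (\<alpha> / d))) * step_mgf \<gamma> (- ln u) = u * (1 - \<gamma>) + \<gamma> / 2 * (1 + u\<^sup>2)"
        using u 2 by (simp add: step_mgf_def cosh_ln_real field_simps power2_eq_square)
      then show ?thesis
        using le[of "- ln u"] by (simp add: f_def)
    qed
    then have "eventually (\<lambda>u. ?p \<le> f u) (at_right 0)"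
      by (auto simp: eventually_at_filter)
    moreover have "(f \<longlongrightarrow> f 0) (at_right 0)"
      unfolding f_def by (intro tendsto_intros)
    ultimately have "?p \<le> f 0"
      by (intro tendsto_lowerbound[of f "f 0"]) auto
    also have "f 0 = 2 * exp (- ln (2 / \<gamma>)) ^ n"
      using \<gamma>(2) by (simp add: f_def exp_minus)
    also have "exp (- ln (2 / \<gamma>)) ^ n = exp (- (n * ln (2 / \<gamma>)))"
      by (simp flip: exp_of_nat_mult)
    finally show ?thesis
      using 2 by (simp add: exponent_def exp_ereal_def numeral_eq_ereal)
  next
    case 3
    then have "\<alpha> * real n > real n * d"
      using d n by (simp add: field_simps)
    then have "?p = 0"
      by (intro max_deviation_eq_0[OF bnd n d])
    then show ?thesis
      using 3 n by (simp add: exponent_def exp_ereal_def)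
  qed
qed

end

section \<open>The extremal random walk\<close>

definition ternary_pmf :: "real \<Rightarrow> real \<Rightarrow> real pmf" where
  "ternary_pmf d \<gamma> = bind_pmf (bernoulli_pmf \<gamma>)
     (\<lambda>b. if b then map_pmf (\<lambda>s. if s then d else - d) (bernoulli_pmf (1 / 2)) else return_pmf 0)"

lemma set_ternary_pmf: "set_pmf (ternary_pmf d \<gamma>) \<subseteq> {- d, 0, d}"
  by (auto simp: ternary_pmf_def split: if_splits)

lemma expectation_ternary_pmf:
  fixes f :: "real \<Rightarrow> real"
  assumes "0 \<le> \<gamma>" "\<gamma> \<le> 1"
  shows "measure_pmf.expectation (ternary_pmf d \<gamma>) f = \<gamma> / 2 * (f d + f (- d)) + (1 - \<gamma>) * f 0"
  unfolding ternary_pmf_def using assms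
  by (subst pmf_expectation_bind[of UNIV]) (auto simp: UNIV_bool field_simps)

definition walk_measure :: "real \<Rightarrow> real \<Rightarrow> (nat \<Rightarrow> real) measure" where
  "walk_measure d \<gamma> = PiM UNIV (\<lambda>_. measure_pmf (ternary_pmf d \<gamma>))"

text \<open>The \<open>\<sigma>\<close>-algebra generated by the first \<open>k\<close> steps, as a preimage under the restriction to \<open>{..<k}\<close>.
  This form makes the independence of disjoint blocks of coordinates directly applicable.\<close>

definition walk_filtration :: "real \<Rightarrow> real \<Rightarrow> nat \<Rightarrow> (nat \<Rightarrow> real) measure" where
  "walk_filtration d \<gamma> k = vimage_algebra (space (walk_measure d \<gamma>)) (\<lambda>\<omega>. restrict \<omega> {..<k})
     (PiM {..<k} (\<lambda>_. measure_pmf (ternary_pmf d \<gamma>)))"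

definition walk :: "nat \<Rightarrow> (nat \<Rightarrow> real) \<Rightarrow> real" where
  "walk k \<omega> = (\<Sum>i<k. \<omega> i)"

locale ternary_walk =
  fixes d \<gamma> :: real
  assumes d: "d > 0" and \<gamma>: "0 < \<gamma>" "\<gamma> \<le> 1"
begin

abbreviation "N \<equiv> measure_pmf (ternary_pmf d \<gamma>)"
abbreviation "M \<equiv> walk_measure d \<gamma>"
abbreviation "F \<equiv> walk_filtration d \<gamma>"

sublocale prob_space M
  unfolding walk_measure_def by (intro prob_space_PiM) (rule measure_pmf.prob_space_axioms)

lemma space_M: "space M = UNIV"
  by (simp add: walk_measure_def space_PiM)

lemma coord_N: "(\<lambda>\<omega>. \<omega> i) \<in> measurable M N"
  unfolding walk_measure_def by (rule measurable_component_singleton) simp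

lemma measurable_function_coord [measurable]: "(\<lambda>\<omega>. f (\<omega> i)) \<in> borel_measurable M"
  using measurable_comp[OF coord_N, of f borel] by (simp add: comp_def)

lemma distr_coord: "distr M N (\<lambda>\<omega>. \<omega> i) = N"
  unfolding walk_measure_def by (rule distr_PiM_component) (auto intro: measure_pmf.prob_space_axioms)

lemma expectation_coord:
  fixes f :: "real \<Rightarrow> real"
  shows "expectation (\<lambda>\<omega>. f (\<omega> i)) = \<gamma> / 2 * (f d + f (- d)) + (1 - \<gamma>) * f 0"
proof -
  have "expectation (\<lambda>\<omega>. f (\<omega> i)) = integral\<^sup>L (distr M N (\<lambda>\<omega>. \<omega> i)) f"
    by (rule integral_distr[OF coord_N, symmetric]) simp
  then show ?thesis
    using \<gamma> by (simp add: distr_coord expectation_ternary_pmf)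
qed

lemma AE_coord: "AE \<omega> in M. \<forall>i. \<omega> i \<in> {- d, 0, d}"
proof -
  have "AE \<omega> in M. \<omega> i \<in> {- d, 0, d}" for i
    unfolding walk_measure_def
    using set_ternary_pmf[of d \<gamma>]
    by (intro AE_PiM_component) (auto intro: measure_pmf.prob_space_axioms simp: AE_measure_pmf_iff)
  then show ?thesis by (simp add: AE_all_countable)
qed

lemma integrable_coord: "integrable M (\<lambda>\<omega>. f (\<omega> i) :: real)"
proof (rule integrable_const_bound)
  show "AE \<omega> in M. norm (f (\<omega> i)) \<le> \<bar>f d\<bar> + \<bar>f (- d)\<bar> + \<bar>f 0\<bar>"
    using AE_coord
  proof eventually_elim
    case (elim \<omega>)
    then have "\<omega> i \<in> {- d, 0, d}" ..
    then show ?case by auto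
  qed
qed measurable

lemma indep_coords: "indep_vars (\<lambda>_. N) (\<lambda>i \<omega>. \<omega> i) UNIV"
proof (subst indep_vars_iff_distr_eq_PiM')
  have "distr M (PiM UNIV (\<lambda>_. N)) (\<lambda>\<omega>. \<lambda>i\<in>UNIV. \<omega> i) = distr M M (\<lambda>\<omega>. \<omega>)"
    by (intro distr_cong) (auto simp: walk_measure_def)
  also have "\<dots> = PiM UNIV (\<lambda>_. N)"
    by (simp add: walk_measure_def)
  finally show "distr M (PiM UNIV (\<lambda>_. N)) (\<lambda>\<omega>. \<lambda>i\<in>UNIV. \<omega> i) = PiM UNIV (\<lambda>i. distr M N (\<lambda>\<omega>. \<omega> i))"
    by (simp add: distr_coord)
qed (rule UNIV_not_empty coord_N)+

lemma restrict_measurable: "(\<lambda>\<omega>. restrict \<omega> {..<k}) \<in> measurable M (PiM {..<k} (\<lambda>_. N))"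
  unfolding walk_measure_def by (rule measurable_restrict_subset) simp

lemma F_sets_iff: "A \<in> sets (F k) \<longleftrightarrow> (\<exists>B\<in>sets (PiM {..<k} (\<lambda>_. N)). A = (\<lambda>\<omega>. restrict \<omega> {..<k}) -` B)"
  unfolding walk_filtration_def
  by (subst sets_vimage_algebra2) (auto simp: space_M space_PiM)

lemma subalgebra_F: "subalgebra M (F k)"
proof -
  have "sets (F k) \<subseteq> sets M"
    using measurable_sets[OF restrict_measurable] by (fastforce simp: F_sets_iff space_M)
  then show ?thesis
    by (simp add: subalgebra_def walk_filtration_def)
qed

lemma coord_F:
  assumes "i < k"
  shows "(\<lambda>\<omega>. \<omega> i) \<in> borel_measurable (F k)"
proof -
  have r: "(\<lambda>\<omega>. restrict \<omega> {..<k}) \<in> measurable (F k) (PiM {..<k} (\<lambda>_. N))"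
    unfolding walk_filtration_def by (rule measurable_vimage_algebra1) (auto simp: space_PiM)
  have "(\<lambda>x. x i) \<in> measurable (PiM {..<k} (\<lambda>_. N)) N"
    using assms by (intro measurable_component_singleton) auto
  from measurable_comp[OF r this] have "(\<lambda>\<omega>. \<omega> i) \<in> measurable (F k) N"
    using assms by (simp add: comp_def)
  then have "(\<lambda>x. x) \<circ> (\<lambda>\<omega>. \<omega> i) \<in> borel_measurable (F k)"
    by (rule measurable_comp) simp
  then show ?thesis by (simp add: comp_def)
qed

lemma sets_F_mono:
  assumes "j \<le> k"
  shows "sets (F j) \<subseteq> sets (F k)"
proof
  fix A assume "A \<in> sets (F j)"
  then obtain B where B: "B \<in> sets (PiM {..<j} (\<lambda>_. N))" and A: "A = (\<lambda>\<omega>. restrict \<omega> {..<j}) -` B"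
    by (auto simp: F_sets_iff)
  have sub: "{..<j} \<subseteq> {..<k}" using assms by auto
  have "(\<lambda>x. restrict x {..<j}) -` B \<inter> space (PiM {..<k} (\<lambda>_. N)) \<in> sets (PiM {..<k} (\<lambda>_. N))"
    using sub by (intro measurable_sets[OF measurable_restrict_subset B])
  moreover have "A = (\<lambda>\<omega>. restrict \<omega> {..<k}) -` ((\<lambda>x. restrict x {..<j}) -` B \<inter> space (PiM {..<k} (\<lambda>_. N)))"
    using sub by (auto simp: A space_PiM Int_absorb1)
  ultimately show "A \<in> sets (F k)"
    unfolding F_sets_iff by (rule bexI[rotated])
qed

lemma finite_measure_subalgebra_F: "finite_measure_subalgebra M (F k)"
  by unfold_locales (rule subalgebra_F)

text \<open>An event \<open>A\<close> of the past is a preimage under the first \<open>k\<close> coordinates, hence independent of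
  coordinate \<open>k\<close>, and the conditional expectation is the constant \<open>E f(\<xi>)\<close>.\<close>

lemma cond_exp_next_step:
  fixes f :: "real \<Rightarrow> real"
  shows "AE \<omega> in M. real_cond_exp M (F k) (\<lambda>\<omega>. f (\<omega> k)) \<omega> = \<gamma> / 2 * (f d + f (- d)) + (1 - \<gamma>) * f 0"
proof -
  interpret F: finite_measure_subalgebra M "F k" by (rule finite_measure_subalgebra_F)
  show ?thesis
  proof (rule F.real_cond_exp_charact)
    fix A assume A: "A \<in> sets (F k)"
    then have AM [measurable]: "A \<in> sets M"
      using subalgebra_F[of k] by (auto simp: subalgebra_def)
    obtain B where B: "B \<in> sets (PiM {..<k} (\<lambda>_. N))" and AB: "A = (\<lambda>\<omega>. restrict \<omega> {..<k}) -` B"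
      using A by (auto simp: F_sets_iff)
    have "indep_var (PiM {..<k} (\<lambda>_. N)) (\<lambda>\<omega>. restrict (\<lambda>i. \<omega> i) {..<k}) (PiM {k} (\<lambda>_. N)) (\<lambda>\<omega>. restrict (\<lambda>i. \<omega> i) {k})"
      by (rule indep_var_restrict[OF indep_coords]) auto
    then have "indep_var borel (indicator B \<circ> (\<lambda>\<omega>. restrict (\<lambda>i. \<omega> i) {..<k}) :: _ \<Rightarrow> real)
        borel ((\<lambda>x. f (x k)) \<circ> (\<lambda>\<omega>. restrict (\<lambda>i. \<omega> i) {k}))"
    proof (rule indep_var_compose)
      show "(\<lambda>x. f (x k)) \<in> borel_measurable (PiM {k} (\<lambda>_. N))"
        using measurable_comp[OF measurable_component_singleton[of k "{k}" "\<lambda>_. N"], of f borel]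
        by (simp add: comp_def)
    qed (use B in simp)
    then have "indep_var borel (indicator A :: _ \<Rightarrow> real) borel (\<lambda>\<omega>. f (\<omega> k))"
      by (simp add: comp_def AB indicator_def [abs_def])
    then have "expectation (\<lambda>\<omega>. indicator A \<omega> * f (\<omega> k)) = expectation (indicator A) * expectation (\<lambda>\<omega>. f (\<omega> k))"
      by (intro indep_var_lebesgue_integral integrable_coord) (auto simp: emeasure_eq_measure)
    then show "(\<integral>\<omega>\<in>A. f (\<omega> k) \<partial>M) = (\<integral>\<omega>\<in>A. (\<gamma> / 2 * (f d + f (- d)) + (1 - \<gamma>) * f 0) \<partial>M)"
      by (simp add: set_lebesgue_integral_def expectation_coord mult.commute)
  qed (auto intro: integrable_coord)
qed

lemma walk_F: "walk k \<in> borel_measurable (F k)"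
  unfolding walk_def by (intro borel_measurable_sum coord_F) auto

lemma walk_increment: "walk (Suc k) \<omega> - walk k \<omega> = \<omega> k"
  by (simp add: walk_def)

lemma integrable_walk: "integrable M (walk k)"
  unfolding walk_def by (intro Bochner_Integration.integrable_sum integrable_coord)

lemma cond_law_increment:
  assumes B: "B \<in> sets borel"
  shows "AE \<omega> in M. cond_law M (F k) (\<lambda>\<omega>. g (\<omega> k)) B \<omega>
    = \<gamma> / 2 * (indicator B (g d) + indicator B (g (- d))) + (1 - \<gamma>) * indicator B (g 0)"
proof -
  have "indicator {\<omega> \<in> space M. g (\<omega> k) \<in> B} = (\<lambda>\<omega>. indicator B (g (\<omega> k)) :: real)"
    by (auto simp: space_M indicator_def)
  then show ?thesis
    unfolding cond_law_def using cond_exp_next_step[of k "\<lambda>x. indicator B (g x)"] by simp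
qed

sublocale conditionally_symmetric_martingale M F walk
proof unfold_locales
  show "space (F i) = space M" for i by (simp add: walk_filtration_def)
  show "i \<le> j \<Longrightarrow> sets (F i) \<subseteq> sets (F j)" for i j by (rule sets_F_mono)
  show "subalgebra M (F k)" for k by (rule subalgebra_F)
  show "walk k \<in> borel_measurable (F k)" for k by (rule walk_F)
  show "integrable M (walk k)" for k by (rule integrable_walk)
  fix k :: nat assume "1 \<le> k"
  then obtain l where k: "k = Suc l" by (cases k) auto
  interpret F: finite_measure_subalgebra M "F l" by (rule finite_measure_subalgebra_F)
  have "AE \<omega> in M. real_cond_exp M (F l) (\<lambda>\<omega>. walk l \<omega> + \<omega> l) \<omega>
      = real_cond_exp M (F l) (walk l) \<omega> + real_cond_exp M (F l) (\<lambda>\<omega>. \<omega> l) \<omega>"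
    by (intro F.real_cond_exp_add integrable_walk integrable_coord[of "\<lambda>x. x"])
  then show "AE \<omega> in M. real_cond_exp M (F (k - 1)) (walk k) \<omega> = walk (k - 1) \<omega>"
    using F.real_cond_exp_F_meas[OF integrable_walk walk_F] cond_exp_next_step[of l "\<lambda>x. x"]
    unfolding k by eventually_elim (simp add: walk_def[abs_def])
  fix B :: "real set" assume B: "B \<in> sets borel"
  show "AE \<omega> in M. cond_law M (F (k - 1)) (\<lambda>\<omega>. walk k \<omega> - walk (k - 1) \<omega>) B \<omega>
              = cond_law M (F (k - 1)) (\<lambda>\<omega>. - (walk k \<omega> - walk (k - 1) \<omega>)) B \<omega>"
    using cond_law_increment[OF B, of l "\<lambda>x. x"] cond_law_increment[OF B, of l uminus]
    unfolding k diff_Suc_1 walk_increment by eventually_elim simp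
qed

lemma bounded_increments_walk:
  assumes "\<gamma> * d\<^sup>2 = \<sigma>\<^sup>2"
  shows "bounded_increments M F walk d \<sigma>"
proof -
  have "AE \<omega> in M. cond_variance M (F l) (walk (Suc l)) \<omega> \<le> \<sigma>\<^sup>2" for l
    using cond_variance_eq[of "Suc l", simplified] cond_exp_next_step[of l "\<lambda>x. x\<^sup>2"]
    unfolding walk_increment by eventually_elim (simp add: assms)
  then have "AE \<omega> in M. \<forall>l. cond_variance M (F l) (walk (Suc l)) \<omega> \<le> \<sigma>\<^sup>2"
    by (simp add: AE_all_countable)
  then show ?thesis
    unfolding bounded_increments_def using AE_coord
  proof eventually_elim
    case (elim \<omega>)
    show ?case
    proof (intro allI impI)
      fix k :: nat assume "1 \<le> k"
      then obtain l where k: "k = Suc l" by (cases k) auto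
      have "\<omega> l \<in> {- d, 0, d}" using elim by blast
      then have "\<bar>\<omega> l\<bar> \<le> d" using d by auto
      then show "\<bar>walk k \<omega> - walk (k - 1) \<omega>\<bar> \<le> d \<and> cond_variance M (F (k - 1)) (walk k) \<omega> \<le> \<sigma>\<^sup>2"
        using elim unfolding k diff_Suc_1 walk_increment by blast
    qed
  qed
qed

lemma
  fixes f :: "real \<Rightarrow> real"
  shows integrable_prod_coords: "integrable M (\<lambda>\<omega>. \<Prod>i<n. f (\<omega> i))"
    and expectation_prod_coords:
      "expectation (\<lambda>\<omega>. \<Prod>i<n. f (\<omega> i)) = (\<gamma> / 2 * (f d + f (- d)) + (1 - \<gamma>) * f 0) ^ n"
proof -
  have "indep_vars (\<lambda>_. N) (\<lambda>i \<omega>. \<omega> i) {..<n}"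
    using indep_coords by (rule indep_vars_subset) simp
  then have ind: "indep_vars (\<lambda>_. borel) (\<lambda>i \<omega>. f (\<omega> i)) {..<n}"
    by (rule indep_vars_compose2) simp
  show "integrable M (\<lambda>\<omega>. \<Prod>i<n. f (\<omega> i))"
    by (intro indep_vars_integrable ind integrable_coord) simp
  have "expectation (\<lambda>\<omega>. \<Prod>i<n. f (\<omega> i)) = (\<Prod>i<n. expectation (\<lambda>\<omega>. f (\<omega> i)))"
    by (intro indep_vars_lebesgue_integral ind integrable_coord) simp
  then show "expectation (\<lambda>\<omega>. \<Prod>i<n. f (\<omega> i)) = (\<gamma> / 2 * (f d + f (- d)) + (1 - \<gamma>) * f 0) ^ n"
    by (simp add: expectation_coord)
qed

lemma
  shows integrable_exp_walk: "integrable M (\<lambda>\<omega>. exp (t * walk n \<omega>))"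
    and expectation_exp_walk: "expectation (\<lambda>\<omega>. exp (t * walk n \<omega>)) = step_mgf \<gamma> (t * d) ^ n"
proof -
  have prod: "exp (t * walk n \<omega>) = (\<Prod>i<n. exp (t * \<omega> i))" for \<omega>
    by (simp add: walk_def sum_distrib_left exp_sum)
  show "integrable M (\<lambda>\<omega>. exp (t * walk n \<omega>))"
    unfolding prod by (rule integrable_prod_coords)
  show "expectation (\<lambda>\<omega>. exp (t * walk n \<omega>)) = step_mgf \<gamma> (t * d) ^ n"
    unfolding prod expectation_prod_coords[where n=n and f="\<lambda>x. exp (t * x)"]
    by (simp add: step_mgf_def cosh_def exp_minus field_simps)
qed

end

section \<open>Large deviations from exponential moments\<close>

context prob_space
begin

text \<open>Each of the three summands dominates \<open>exp (y S)\<close> on one of the regions \<open>S < a\<close>, \<open>S > b\<close> and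
  \<open>a \<le> S \<le> b\<close>: on the first \<open>exp ((y - x) S) \<le> exp ((y - x) a)\<close>, and similarly on the second. This
  replaces the law of large numbers under the tilted measure.\<close>

lemma tilting_lower_bound:
  assumes [measurable]: "S \<in> borel_measurable M"
    and int: "\<And>y. integrable M (\<lambda>\<omega>. exp (y * S \<omega>))"
    and ord: "0 \<le> y" "x < y" "y < z"
  shows "expectation (\<lambda>\<omega>. exp (y * S \<omega>))
    \<le> exp ((y - x) * a) * expectation (\<lambda>\<omega>. exp (x * S \<omega>))
      + exp ((y - z) * b) * expectation (\<lambda>\<omega>. exp (z * S \<omega>))
      + exp (y * b) * prob {\<omega> \<in> space M. S \<omega> \<ge> a}"
proof -
  let ?A = "{\<omega> \<in> space M. S \<omega> \<ge> a}"
  have A: "integrable M (\<lambda>\<omega>. indicator ?A \<omega> :: real)"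
    by (intro integrable_real_indicator) (auto simp: emeasure_eq_measure)
  have "expectation (\<lambda>\<omega>. exp (y * S \<omega>))
    \<le> expectation (\<lambda>\<omega>. exp ((y - x) * a) * exp (x * S \<omega>) + exp ((y - z) * b) * exp (z * S \<omega>)
        + exp (y * b) * indicator ?A \<omega>)"
  proof (rule integral_mono)
    fix \<omega> assume w: "\<omega> \<in> space M"
    consider "S \<omega> < a" | "S \<omega> > b" | "a \<le> S \<omega>" "S \<omega> \<le> b" by linarith
    then show "exp (y * S \<omega>) \<le> exp ((y - x) * a) * exp (x * S \<omega>) + exp ((y - z) * b) * exp (z * S \<omega>)
        + exp (y * b) * indicator ?A \<omega>"
    proof cases
      case 1
      then have "(y - x) * S \<omega> \<le> (y - x) * a" using ord by simp
      then have "exp (y * S \<omega>) \<le> exp ((y - x) * a) * exp (x * S \<omega>)"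
        by (simp add: algebra_simps flip: exp_add)
      then show ?thesis by (simp add: add_increasing2)
    next
      case 2
      then have "(z - y) * b \<le> (z - y) * S \<omega>" using ord by simp
      then have "exp (y * S \<omega>) \<le> exp ((y - z) * b) * exp (z * S \<omega>)"
        by (simp add: algebra_simps flip: exp_add)
      then show ?thesis by (simp add: add_increasing add_increasing2)
    next
      case 3
      then have "exp (y * S \<omega>) \<le> exp (y * b) * indicator ?A \<omega>"
        using w ord by (simp add: mult_left_mono)
      then show ?thesis by (simp add: add_increasing)
    qed
  qed (rule int, intro Bochner_Integration.integrable_add integrable_mult_right int A)
  also have "\<dots> = exp ((y - x) * a) * expectation (\<lambda>\<omega>. exp (x * S \<omega>))
      + exp ((y - z) * b) * expectation (\<lambda>\<omega>. exp (z * S \<omega>)) + exp (y * b) * prob ?A"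
    using int A by (subst Bochner_Integration.integral_add integrable_add; simp)+
  finally show ?thesis .
qed

end

text \<open>A constant factor does not affect an exponential rate. The lower bound is only required for each
  rate \<open>s\<close> strictly below \<open>r\<close>.\<close>

lemma exponential_rate_of_two_sided_bound:
  fixes p :: "nat \<Rightarrow> real" and r :: real
  assumes upper: "\<And>n. n \<ge> 1 \<Longrightarrow> p n \<le> 2 * exp (real n * r)"
    and lower: "\<And>s. s < r \<Longrightarrow> eventually (\<lambda>n. p n \<ge> exp (real n * s) / 2) sequentially"
  shows "(\<lambda>n. ereal (1 / real n) * ln_ereal (p n)) \<longlonglongrightarrow> ereal r"
proof -
  have pos: "eventually (\<lambda>n. p n > 0) sequentially"
    using lower[of "r - 1"]
    by (auto elim!: eventually_mono intro: less_le_trans[of 0 "exp _ / 2"])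
  have "(\<lambda>n. ln (p n) / n) \<longlonglongrightarrow> r"
  proof (rule order_tendstoI)
    fix c assume "c < r"
    define s where "s = (c + r) / 2"
    have s: "s < r" "c < s" using \<open>c < r\<close> by (auto simp: s_def field_simps)
    have "(\<lambda>n. s - ln 2 / real n) \<longlonglongrightarrow> s - 0"
      by (intro tendsto_intros lim_const_over_n)
    then have "eventually (\<lambda>n. c < s - ln 2 / real n) sequentially"
      using s by (intro order_tendstoD) auto
    then show "eventually (\<lambda>n. c < ln (p n) / n) sequentially"
      using lower[OF s(1)] eventually_gt_at_top[of 0]
    proof eventually_elim
      case (elim n)
      have "ln (exp (n * s) / 2) \<le> ln (p n)"
        using elim by (intro ln_mono) (auto intro: less_le_trans[of 0 "exp _ / 2"])
      then have "n * s - ln 2 \<le> ln (p n)" by (simp add: ln_div)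
      then have "(n * s - ln 2) / n \<le> ln (p n) / n" by (rule divide_right_mono) simp
      then have "s - ln 2 / n \<le> ln (p n) / n" using elim by (simp add: diff_divide_distrib)
      then show ?case using elim by simp
    qed
  next
    fix c assume "r < c"
    have "(\<lambda>n. r + ln 2 / real n) \<longlonglongrightarrow> r + 0"
      by (intro tendsto_intros lim_const_over_n)
    then have "eventually (\<lambda>n. r + ln 2 / real n < c) sequentially"
      using \<open>r < c\<close> by (intro order_tendstoD) auto
    then show "eventually (\<lambda>n. ln (p n) / n < c) sequentially"
      using pos eventually_gt_at_top[of 0]
    proof eventually_elim
      case (elim n)
      have "ln (p n) \<le> ln (2 * exp (n * r))"
        using elim upper[of n] by (intro ln_mono) auto
      then have "ln (p n) \<le> ln 2 + n * r" by (simp add: ln_mult)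
      then have "ln (p n) / n \<le> (ln 2 + n * r) / n" by (rule divide_right_mono) simp
      then have "ln (p n) / n \<le> r + ln 2 / n" using elim by (simp add: add_divide_distrib)
      then show ?case using elim by simp
    qed
  qed
  then have "(\<lambda>n. ereal (ln (p n) / n)) \<longlonglongrightarrow> ereal r"
    by simp
  then show ?thesis
  proof (rule Lim_transform_eventually)
    show "eventually (\<lambda>n. ereal (ln (p n) / n) = ereal (1 / real n) * ln_ereal (p n)) sequentially"
      using pos by eventually_elim (simp add: ln_ereal_def)
  qed
qed

context ternary_walk
begin

lemma prob_walk_le_max_deviation:
  assumes "n \<ge> 1"
  shows "prob {\<omega> \<in> space M. walk n \<omega> \<ge> a} \<le> max_deviation_prob M walk n a"
  unfolding max_deviation_prob_def
proof (rule finite_measure_mono)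
  have "walk n \<omega> \<le> (MAX k\<in>{1..n}. \<bar>walk k \<omega> - walk 0 \<omega>\<bar>)" for \<omega>
  proof -
    have "walk n \<omega> \<le> \<bar>walk n \<omega> - walk 0 \<omega>\<bar>"
      by (simp add: walk_def)
    also have "\<dots> \<le> (MAX k\<in>{1..n}. \<bar>walk k \<omega> - walk 0 \<omega>\<bar>)"
      using assms by (intro Max_ge) auto
    finally show ?thesis .
  qed
  then show "{\<omega> \<in> space M. walk n \<omega> \<ge> a} \<subseteq> {\<omega> \<in> space M. (MAX k\<in>{1..n}. \<bar>walk k \<omega> - walk 0 \<omega>\<bar>) \<ge> a}"
    by (auto intro: order_trans)
qed measurable

lemma prob_walk_top: "prob {\<omega> \<in> space M. walk n \<omega> \<ge> d * real n} \<ge> (\<gamma> / 2) ^ n"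
proof -
  have "(\<gamma> / 2) ^ n = expectation (\<lambda>\<omega>. \<Prod>i<n. indicator {d} (\<omega> i))"
    using d by (subst expectation_prod_coords) auto
  also have "\<dots> \<le> expectation (indicator {\<omega> \<in> space M. walk n \<omega> \<ge> d * real n})"
  proof (rule integral_mono)
    fix \<omega> assume "\<omega> \<in> space M"
    show "(\<Prod>i<n. indicator {d} (\<omega> i) :: real) \<le> indicator {\<omega> \<in> space M. walk n \<omega> \<ge> d * real n} \<omega>"
    proof (cases "\<forall>i<n. \<omega> i = d")
      case True
      then have "walk n \<omega> = d * real n" by (simp add: walk_def)
      then show ?thesis using True by (simp add: space_M)
    next
      case False
      then obtain i where "i < n" "\<omega> i \<noteq> d" by auto
      then have "(\<Prod>i<n. indicator {d} (\<omega> i) :: real) = 0"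
        by (intro prod_zero bexI[of _ i]) auto
      then show ?thesis by (simp only: indicator_pos_le)
    qed
  qed (auto intro!: integrable_prod_coords integrable_real_indicator simp: emeasure_eq_measure)
  finally show ?thesis by simp
qed

text \<open>Tilting at \<open>y = x + h\<close>, with \<open>z = x + 2 h\<close> and with the slopes at \<open>x\<close> and \<open>z\<close> as thresholds. The two error
  terms, relative to \<open>C(y)\<^sup>n\<close>, are \<open>exp (u n)\<close> and \<open>exp (v n)\<close>, and \<open>u\<close> and \<open>v\<close> are negative because
  \<open>ln C\<close> lies strictly above its tangents at \<open>x\<close> and \<open>z\<close>.\<close>

lemma eventually_prob_walk_ge:
  assumes \<delta>: "0 \<le> \<delta>" "\<delta> < 1" and h: "h > 0"
  defines "x \<equiv> exponent_point \<gamma> \<delta>"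
  shows "eventually (\<lambda>n. prob {\<omega> \<in> space M. walk n \<omega> \<ge> \<delta> * d * real n}
    \<ge> exp (n * (ln (step_mgf \<gamma> (x + h)) - (x + h) * tilted_mean \<gamma> (x + 2 * h))) / 2) sequentially"
proof -
  define y z b where "y = x + h" and "z = x + 2 * h" and "b = tilted_mean \<gamma> z"
  define \<Lambda> where "\<Lambda> t = ln (step_mgf \<gamma> t)" for t
  have exp_\<Lambda>: "step_mgf \<gamma> t = exp (\<Lambda> t)" for t
    using \<gamma> by (simp add: \<Lambda>_def step_mgf_pos)
  have ord: "0 \<le> y" "x < y" "y < z"
    using h exponent_point_nonneg[OF \<gamma> \<delta>] by (auto simp: y_def z_def x_def)
  define u v where "u = (y - x) * \<delta> + \<Lambda> x - \<Lambda> y" and "v = (y - z) * b + \<Lambda> z - \<Lambda> y"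
  have "u < 0"
    using ln_step_mgf_above_tangent[OF \<gamma>, of x y] ord \<gamma> \<delta>
    by (simp add: u_def \<Lambda>_def x_def tilted_mean_exponent_point algebra_simps)
  have "v < 0"
    using ln_step_mgf_above_tangent[OF \<gamma>, of z y] ord
    by (simp add: v_def \<Lambda>_def b_def algebra_simps)
  have "(\<lambda>n. exp u ^ n + exp v ^ n) \<longlonglongrightarrow> 0 + 0"
    using \<open>u < 0\<close> \<open>v < 0\<close> by (intro tendsto_add LIMSEQ_power_zero) auto
  then have "eventually (\<lambda>n. exp u ^ n + exp v ^ n < 1 / 2) sequentially"
    by (intro order_tendstoD) auto
  then show ?thesis
  proof eventually_elim
    case (elim n)
    let ?P = "prob {\<omega> \<in> space M. walk n \<omega> \<ge> \<delta> * d * real n}"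
    have "expectation (\<lambda>\<omega>. exp (y / d * walk n \<omega>))
      \<le> exp ((y / d - x / d) * (\<delta> * d * real n)) * expectation (\<lambda>\<omega>. exp (x / d * walk n \<omega>))
        + exp ((y / d - z / d) * (b * d * real n)) * expectation (\<lambda>\<omega>. exp (z / d * walk n \<omega>))
        + exp (y / d * (b * d * real n)) * ?P"
      using ord d by (intro tilting_lower_bound integrable_exp_walk X_measurable) (auto simp: divide_strict_right_mono)
    also have "(y / d - x / d) * (\<delta> * d * real n) = n * ((y - x) * \<delta>)"
      using d by (simp add: field_simps)
    also have "(y / d - z / d) * (b * d * real n) = n * ((y - z) * b)"
      using d by (simp add: field_simps)
    also have "y / d * (b * d * real n) = n * (y * b)"
      using d by (simp add: field_simps)
    finally have "expectation (\<lambda>\<omega>. exp (y / d * walk n \<omega>))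
      \<le> exp (n * ((y - x) * \<delta>)) * expectation (\<lambda>\<omega>. exp (x / d * walk n \<omega>))
        + exp (n * ((y - z) * b)) * expectation (\<lambda>\<omega>. exp (z / d * walk n \<omega>))
        + exp (n * (y * b)) * ?P" .
    then have "exp (n * \<Lambda> y) \<le> exp (n * ((y - x) * \<delta>)) * exp (n * \<Lambda> x)
        + exp (n * ((y - z) * b)) * exp (n * \<Lambda> z) + exp (n * (y * b)) * ?P"
      unfolding expectation_exp_walk using d by (simp add: exp_\<Lambda> flip: exp_of_nat_mult)
    then have "exp (n * \<Lambda> y) \<le> exp (n * \<Lambda> y) * (exp u ^ n + exp v ^ n) + exp (n * (y * b)) * ?P"
      by (simp add: u_def v_def algebra_simps flip: exp_of_nat_mult exp_add)
    also have "exp (n * \<Lambda> y) * (exp u ^ n + exp v ^ n) \<le> exp (n * \<Lambda> y) * (1 / 2)"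
      using elim by (intro mult_left_mono) auto
    finally have "exp (n * \<Lambda> y) / 2 \<le> exp (n * (y * b)) * ?P" by simp
    then have "exp (n * \<Lambda> y) / exp (n * (y * b)) / 2 \<le> ?P"
      by (simp add: field_simps)
    then show ?case
      by (simp add: \<Lambda>_def y_def z_def b_def right_diff_distrib exp_diff)
  qed
qed

text \<open>At \<open>h = 0\<close> the rate of \<open>eventually_prob_walk_ge\<close> is \<open>- E(\<gamma>, \<delta>)\<close>; continuity in \<open>h\<close> does the rest.\<close>

lemma eventually_prob_walk_ge_rate:
  fixes s :: real
  assumes \<delta>: "0 \<le> \<delta>" "\<delta> < 1"
    and s: "s < ln (step_mgf \<gamma> (exponent_point \<gamma> \<delta>)) - \<delta> * exponent_point \<gamma> \<delta>"
  shows "eventually (\<lambda>n. prob {\<omega> \<in> space M. walk n \<omega> \<ge> \<delta> * d * real n} \<ge> exp (n * s) / 2) sequentially"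
proof -
  define x where "x = exponent_point \<gamma> \<delta>"
  define L where "L h = ln (step_mgf \<gamma> (x + h)) - (x + h) * tilted_mean \<gamma> (x + 2 * h)" for h
  have "isCont (\<lambda>x. ln (step_mgf \<gamma> x)) t" "isCont (tilted_mean \<gamma>) t" for t
    using \<gamma> DERIV_isCont[OF DERIV_ln_step_mgf] isCont_tilted_mean by auto
  note cont = this
  have "isCont (\<lambda>h. ln (step_mgf \<gamma> (x + h))) 0"
    by (rule isCont_o2[OF _ cont(1)]) (intro continuous_intros)
  moreover have "isCont (\<lambda>h. tilted_mean \<gamma> (x + 2 * h)) 0"
    by (rule isCont_o2[OF _ cont(2)]) (intro continuous_intros)
  ultimately have "isCont L 0"
    unfolding L_def by (intro isCont_diff isCont_mult isCont_add continuous_const continuous_ident)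
  then have "(L \<longlongrightarrow> L 0) (at_right 0)"
    unfolding isCont_def by (rule filterlim_mono) (auto intro: at_le)
  moreover have "L 0 > s"
    using s \<gamma> \<delta> by (simp add: L_def x_def tilted_mean_exponent_point mult.commute)
  ultimately have "eventually (\<lambda>h. L h > s) (at_right 0)"
    by (rule order_tendstoD)
  then obtain e where "e > 0" and e: "\<And>h. 0 < h \<Longrightarrow> h < e \<Longrightarrow> L h > s"
    by (auto simp: eventually_at_right_field)
  then have h: "e / 2 > 0" "L (e / 2) > s"
    by auto
  show ?thesis
    using eventually_prob_walk_ge[OF \<delta> h(1)]
  proof eventually_elim
    case (elim n)
    have "exp (n * s) / 2 \<le> exp (n * L (e / 2)) / 2"
      using h(2) by (simp add: mult_left_mono)
    also have "\<dots> \<le> prob {\<omega> \<in> space M. walk n \<omega> \<ge> \<delta> * d * real n}"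
      using elim by (simp only: L_def x_def)
    finally show ?case .
  qed
qed

lemma walk_attains_exponent:
  assumes "\<alpha> \<ge> 0"
  shows "(\<lambda>n. ereal (1 / real n) * ln_ereal (max_deviation_prob M walk n (\<alpha> * real n)))
    \<longlonglongrightarrow> - exponent \<gamma> (\<alpha> / d)"
proof -
  define \<delta> where "\<delta> = \<alpha> / d"
  let ?p = "\<lambda>n. max_deviation_prob M walk n (\<alpha> * real n)"
  have \<alpha>: "\<alpha> = \<delta> * d" and "\<delta> \<ge> 0"
    using d assms by (auto simp: \<delta>_def)
  define \<sigma> where "\<sigma> = d * sqrt \<gamma>"
  have \<sigma>: "\<gamma> * d\<^sup>2 = \<sigma>\<^sup>2" "\<gamma> = \<sigma>\<^sup>2 / d\<^sup>2"
    using d \<gamma> by (auto simp: \<sigma>_def power_mult_distrib)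
  note bnd = bounded_increments_walk[OF \<sigma>(1)]
  have upper: "ereal (?p n) \<le> 2 * exp_ereal (- (ereal (real n) * exponent \<gamma> \<delta>))" if "n \<ge> 1" for n
    using max_deviation_le_exponent[OF bnd d \<sigma>(2) \<gamma>(1) assms that] by (simp add: \<delta>_def)
  have upper': "?p n \<le> 2 * exp (real n * - E)" if "exponent \<gamma> \<delta> = ereal E" "n \<ge> 1" for n E
    using upper[of n] that by (simp add: exp_ereal_def numeral_eq_ereal)
  consider "\<delta> < 1" | "\<delta> = 1" | "\<delta> > 1" by linarith
  then have "(\<lambda>n. ereal (1 / real n) * ln_ereal (?p n)) \<longlonglongrightarrow> - exponent \<gamma> \<delta>"
  proof cases
    case 1
    define x where "x = exponent_point \<gamma> \<delta>"
    define E where "E = \<delta> * x - ln (step_mgf \<gamma> x)"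
    have E: "exponent \<gamma> \<delta> = ereal E"
      using 1 by (simp add: exponent_def E_def x_def step_mgf_def)
    have "(\<lambda>n. ereal (1 / real n) * ln_ereal (?p n)) \<longlonglongrightarrow> ereal (- E)"
    proof (rule exponential_rate_of_two_sided_bound)
      fix s assume "s < - E"
      then have "eventually (\<lambda>n. prob {\<omega> \<in> space M. walk n \<omega> \<ge> \<delta> * d * real n} \<ge> exp (n * s) / 2) sequentially"
        using eventually_prob_walk_ge_rate[OF \<open>\<delta> \<ge> 0\<close> 1] by (simp add: E_def x_def)
      then show "eventually (\<lambda>n. ?p n \<ge> exp (n * s) / 2) sequentially"
        using eventually_ge_at_top[of 1]
        unfolding \<alpha> by eventually_elim (rule order_trans[OF _ prob_walk_le_max_deviation])
    qed (rule upper'[OF E])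
    then show ?thesis by (simp add: E)
  next
    case 2
    have E: "exponent \<gamma> \<delta> = ereal (ln (2 / \<gamma>))"
      using 2 by (simp add: exponent_def)
    have "(\<lambda>n. ereal (1 / real n) * ln_ereal (?p n)) \<longlonglongrightarrow> ereal (- ln (2 / \<gamma>))"
    proof (rule exponential_rate_of_two_sided_bound)
      fix s assume s: "s < - ln (2 / \<gamma>)"
      show "eventually (\<lambda>n. ?p n \<ge> exp (n * s) / 2) sequentially"
        using eventually_ge_at_top[of 1]
      proof eventually_elim
        case (elim n)
        have "exp (real n * s) / 2 \<le> exp (real n * s)" by simp
        also have "\<dots> \<le> exp (real n * - ln (2 / \<gamma>))"
          unfolding exp_le_cancel_iff using s by (intro mult_left_mono) auto
        also have "\<dots> = (\<gamma> / 2) ^ n"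
          using \<gamma> by (simp add: exp_of_nat_mult ln_div exp_diff)
        also have "\<dots> \<le> ?p n"
          using prob_walk_top[of n] prob_walk_le_max_deviation[OF elim, of "d * real n"]
          by (simp add: \<alpha> 2)
        finally show ?case .
      qed
    qed (rule upper'[OF E])
    then show ?thesis by (simp add: E)
  next
    case 3
    have zero: "?p n = 0" if "n \<ge> 1" for n
      using 3 d that by (intro max_deviation_eq_0[OF bnd]) (auto simp: \<alpha>)
    have "eventually (\<lambda>n. ereal (1 / real n) * ln_ereal (?p n) = - exponent \<gamma> \<delta>) sequentially"
      using eventually_ge_at_top[of 1]
      by eventually_elim (use 3 in \<open>simp add: zero ln_ereal_def exponent_def\<close>)
    then show ?thesis by (rule tendsto_eventually)
  qed
  then show ?thesis by (simp add: \<delta>_def)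
qed

end

section \<open>The bound and its optimality\<close>

theorem theorem1:
  fixes d \<sigma> \<gamma> :: real
  assumes "d > 0" and "\<sigma> > 0" and "\<sigma> \<le> d" and "\<gamma> = \<sigma>\<^sup>2 / d\<^sup>2"
  shows
    "(\<forall>(M :: 'a measure) F X.
        conditionally_symmetric_martingale M F X \<and> bounded_increments M F X d \<sigma> \<longrightarrow>
        (\<forall>\<alpha> n. \<alpha> \<ge> 0 \<and> n \<ge> 1 \<longrightarrow>
           ereal (max_deviation_prob M X n (\<alpha> * real n))
             \<le> 2 * exp_ereal (- (ereal (real n) * exponent \<gamma> (\<alpha> / d)))
           \<and> (\<alpha> / d > 1 \<longrightarrow> max_deviation_prob M X n (\<alpha> * real n) = 0)))
     \<and>
     (\<exists>(M :: (nat \<Rightarrow> real) measure) F X.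
        conditionally_symmetric_martingale M F X \<and> bounded_increments M F X d \<sigma> \<and>
        (\<forall>\<alpha>\<ge>0. (\<lambda>n. ereal (1 / real n) * ln_ereal (max_deviation_prob M X n (\<alpha> * real n)))
                   \<longlonglongrightarrow> - exponent \<gamma> (\<alpha> / d)))"
proof (rule conjI)
  have \<gamma>: "0 < \<gamma>" "\<gamma> \<le> 1"
    unfolding assms(4) using assms(1-3) power_mono[of \<sigma> d 2] by simp_all
  show "\<forall>(M :: 'a measure) F X.
        conditionally_symmetric_martingale M F X \<and> bounded_increments M F X d \<sigma> \<longrightarrow>
        (\<forall>\<alpha> n. \<alpha> \<ge> 0 \<and> n \<ge> 1 \<longrightarrow>
           ereal (max_deviation_prob M X n (\<alpha> * real n))
             \<le> 2 * exp_ereal (- (ereal (real n) * exponent \<gamma> (\<alpha> / d)))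
           \<and> (\<alpha> / d > 1 \<longrightarrow> max_deviation_prob M X n (\<alpha> * real n) = 0))"
  proof (intro allI impI conjI)
    fix M :: "'a measure" and F X and \<alpha> :: real and n :: nat
    assume MX: "conditionally_symmetric_martingale M F X \<and> bounded_increments M F X d \<sigma>"
      and \<alpha>n: "\<alpha> \<ge> 0 \<and> n \<ge> 1"
    interpret conditionally_symmetric_martingale M F X
      using MX by (rule conjunct1)
    note bnd = MX[THEN conjunct2] and n = \<alpha>n[THEN conjunct2]
    show "ereal (max_deviation_prob M X n (\<alpha> * real n))
        \<le> 2 * exp_ereal (- (ereal (real n) * exponent \<gamma> (\<alpha> / d)))"
      by (rule max_deviation_le_exponent[OF bnd \<open>d > 0\<close> assms(4) \<gamma>(1) \<alpha>n[THEN conjunct1] n])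
    assume "\<alpha> / d > 1"
    then have "\<alpha> * real n > real n * d"
      using \<open>d > 0\<close> n by (simp add: less_divide_eq)
    then show "max_deviation_prob M X n (\<alpha> * real n) = 0"
      by (rule max_deviation_eq_0[OF bnd n \<open>d > 0\<close>])
  qed
  interpret ternary_walk d \<gamma>
    using \<open>d > 0\<close> \<gamma> by unfold_locales
  have "\<gamma> * d\<^sup>2 = \<sigma>\<^sup>2"
    unfolding assms(4) using \<open>d > 0\<close> by simp
  then have bnd: "bounded_increments M F walk d \<sigma>"
    by (rule bounded_increments_walk)
  show "\<exists>(M :: (nat \<Rightarrow> real) measure) F X.
        conditionally_symmetric_martingale M F X \<and> bounded_increments M F X d \<sigma> \<and>
        (\<forall>\<alpha>\<ge>0. (\<lambda>n. ereal (1 / real n) * ln_ereal (max_deviation_prob M X n (\<alpha> * real n)))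
                   \<longlonglongrightarrow> - exponent \<gamma> (\<alpha> / d))"
  proof (rule exI[where x=M], rule exI[where x=F], rule exI[where x=walk], intro conjI allI impI)
    show "conditionally_symmetric_martingale M F walk"
      by (rule conditionally_symmetric_martingale_axioms)
    show "bounded_increments M F walk d \<sigma>"
      by (rule bnd)
    fix \<alpha> :: real assume "\<alpha> \<ge> 0"
    then show "(\<lambda>n. ereal (1 / real n) * ln_ereal (max_deviation_prob M walk n (\<alpha> * real n)))
        \<longlonglongrightarrow> - exponent \<gamma> (\<alpha> / d)"
      by (rule walk_attains_exponent)
  qed
qed

end
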